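(* Let $(X_1,\dots,X_n)$ be the output of $\textsc{DepRound}$ run with probabilities $(p_1,\dots,p_n)\in(0,1)^n$ and positive weights $(a_1,\dots,a_n)$. Let $I^+,I^-$ be disjoint subsets of $[n]$, $I:=I^+\cup I^-$, $t:=|I|$, $\alpha:=\min_i\min\{p_i,1-p_i\}$, and $\lambda:=\prod_{i\in I^+}p_i\prod_{i\in I^-}(1-p_i)$. If $\max_{i,j}a_i/a_j\le 2$, then $$\left(1-\frac{16t(t-1)}{7n\alpha^3}\right)\lambda\le\mathbf{E}\left[\prod_{i\in I^+}X_i\prod_{i\in I^-}(1-X_i)\right]\le\left(1+\frac{16t}{7n\alpha^3}\right)^{t-1}\lambda.$$
   Context: For $a_1,a_2>0$, $\beta_1,\beta_2\in(0,1)$, $\textsc{Simplify}(a_1,a_2,\beta_1,\beta_2)$ outputs $(\gamma_1,\gamma_2)$: let $s=a_1\beta_1+a_2\beta_2$ and apply the first case whose condition holds. Case I ($s\le\min\{a_1,a_2\}$): w.p. $a_2\beta_2/s$ set $\gamma_1=0$, otherwise $\gamma_2=0$. Case II ($a_1<s<a_2$): w.p. $\beta_1$ set $\gamma_1=1$, otherwise $\gamma_1=0$. Case III ($a_2<s<a_1$): w.p. $\beta_2$ set $\gamma_2=1$, otherwise $\gamma_2=0$. Case IV ($\max\{a_1,a_2\}\le s\le a_1+a_2$): w.p. $a_2(1-\beta_2)/(a_1(1-\beta_1)+a_2(1-\beta_2))$ set $\gamma_1=1$, otherwise $\gamma_2=1$. Then: if $\gamma_1=0$, $\gamma_2=\beta_2+\beta_1a_1/a_2$;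 if $\gamma_1=1$, $\gamma_2=\beta_2-(1-\beta_1)a_1/a_2$; if $\gamma_2=0$, $\gamma_1=\beta_1+\beta_2a_2/a_1$; if $\gamma_2=1$, $\gamma_1=\beta_1-(1-\beta_2)a_2/a_1$. $\textsc{DepRound}$ with $P=(p_1,\dots,p_n)$ and weights $A=(a_1,\dots,a_n)$: set $X=P$; choose a uniformly random permutation $\pi$ of $[n]$; while $X$ has at least two entries in $(0,1)$, let $X_i,X_j$ be the two fractional entries earliest in the $\pi$-order ($X_i$ first) and replace $(X_i,X_j)$ by $\textsc{Simplify}(a_i,a_j,X_i,X_j)$; output $X$ (all entries lie in $[0,1]$, at most one of them fractional). *)

theory Defs
  imports "HOL-Probability.Probability" "HOL-Combinatorics.Multiset_Permutations"
begin

(* For a1, a2 > 0 and b1, b2 in (0,1) the last branch is exactly the case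
   max a1 a2 <= s <= a1 + a2.  Values of simplify for other arguments are irrelevant. *)
definition simplify :: "real \<Rightarrow> real \<Rightarrow> real \<Rightarrow> real \<Rightarrow> (real \<times> real) pmf" where
  "simplify a1 a2 b1 b2 =
     (let s = a1 * b1 + a2 * b2;
          first_0 = (0, b2 + b1 * a1 / a2);
          first_1 = (1, b2 - (1 - b1) * a1 / a2);
          second_0 = (b1 + b2 * a2 / a1, 0);
          second_1 = (b1 - (1 - b2) * a2 / a1, 1)
      in if s \<le> min a1 a2 then
           map_pmf (\<lambda>c. if c then first_0 else second_0) (bernoulli_pmf (a2 * b2 / s))
         else if a1 < s \<and> s < a2 then
           map_pmf (\<lambda>c. if c then first_1 else first_0) (bernoulli_pmf b1)
         else if a2 < s \<and> s < a1 then
           map_pmf (\<lambda>c. if c then second_1 else second_0) (bernoulli_pmf b2)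
         else
           map_pmf (\<lambda>c. if c then first_1 else second_1)
             (bernoulli_pmf (a2 * (1 - b2) / (a1 * (1 - b1) + a2 * (1 - b2)))))"

lemma simplify_fixes_one:
  assumes "(g, h) \<in> set_pmf (simplify a1 a2 b1 b2)"
  shows "g \<in> {0, 1} \<or> h \<in> {0, 1}"
  using assms unfolding simplify_def Let_def by (auto split: if_splits)

definition fractional :: "real \<Rightarrow> bool" where
  "fractional x \<longleftrightarrow> 0 < x \<and> x < 1"

(* The loop of DepRound for a fixed permutation: the list \<pi> enumerates the indices from
   earliest to latest.  It is only used for duplicate-free lists; remdups leaves those
   unchanged and makes the recursion terminate for all arguments. *)
function dep_round_loop ::
    "(nat \<Rightarrow> real) \<Rightarrow> nat list \<Rightarrow> (nat \<Rightarrow> real) \<Rightarrow> (nat \<Rightarrow> real) pmf" where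
  "dep_round_loop a \<pi> X =
     (case filter (\<lambda>k. fractional (X k)) (remdups \<pi>) of
        i # j # _ \<Rightarrow>
          bind_pmf (simplify (a i) (a j) (X i) (X j))
            (\<lambda>(g, h). dep_round_loop a \<pi> (X(i := g, j := h)))
      | _ \<Rightarrow> return_pmf X)"
  by pat_completeness auto

lemma card_fractional_less:
  assumes "filter (\<lambda>k. fractional (X k)) (remdups \<pi>) = i # j # ks"
    and "g \<in> {0, 1} \<or> h \<in> {0, 1}"
  shows "card {k \<in> set \<pi>. fractional ((X(i := g, j := h)) k)}
       < card {k \<in> set \<pi>. fractional (X k)}"
proof (rule psubset_card_mono)
  have ij: "i \<in> {k \<in> set \<pi>. fractional (X k)}" "j \<in> {k \<in> set \<pi>. fractional (X k)}"
    using arg_cong[OF assms(1), of set] by auto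
  have "distinct (i # j # ks)"
    using assms(1) distinct_filter distinct_remdups by metis
  then have "i \<noteq> j" by simp
  then show "{k \<in> set \<pi>. fractional ((X(i := g, j := h)) k)}
      \<subset> {k \<in> set \<pi>. fractional (X k)}"
    using ij assms(2) by (auto simp: fractional_def split: if_splits)
qed simp

termination dep_round_loop
  by (relation "Wellfounded.measure (\<lambda>(a, \<pi>, X). card {k \<in> set \<pi>. fractional (X k)})")
     (auto intro!: card_fractional_less dest: simplify_fixes_one simp del: fun_upd_apply)

declare dep_round_loop.simps [simp del]

(* Only the values of a and p on {1..n} matter; outside {1..n} the output agrees with p. *)
definition dep_round :: "nat \<Rightarrow> (nat \<Rightarrow> real) \<Rightarrow> (nat \<Rightarrow> real) \<Rightarrow> (nat \<Rightarrow> real) pmf" where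
  "dep_round n p a =
     bind_pmf (pmf_of_set (permutations_of_set {1..n})) (\<lambda>\<pi>. dep_round_loop a \<pi> p)"

end

theory Submission
  imports Defs
begin

text \<open>
At every time at most one index, the carry, is fractional and already touched; each step combines
it with the next index of the random order, and all later indices still have their initial values.
A step preserves the mean of each coordinate, so the expected product can change only when a carry
from \<open>I\<close> meets another index of \<open>I\<close>; such a collision changes it by a factor between \<open>0\<close> and \<open>1 / \<alpha>\<close>.

A carry does not survive for long.  Write \<open>z\<close> for its literal (\<open>X\<^sub>c\<close> or \<open>1 - X\<^sub>c\<close>).  Under the law
reweighted by \<open>z\<close>, the potential \<open>2 / \<alpha>\<^sup>3 * (8/7 - z)\<close> drops by at least \<open>1 / \<alpha> - 1\<close> in expectation
at each step in which the carry meets an index outside \<open>I\<close>.  It never exceeds \<open>16 / (7 \<alpha>\<^sup>3)\<close>, which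
therefore bounds the total expected excess charged to one carry.  Since the remaining order is
uniform, the next index lies in \<open>I\<close> with probability \<open>k / N\<close>, where \<open>k\<close> of the \<open>N\<close> remaining indices
belong to \<open>I\<close>, and an induction on \<open>N\<close> adds up the excesses.
\<close>

section \<open>One step of the rounding\<close>

abbreviation two_point :: "real \<Rightarrow> 'a \<Rightarrow> 'a \<Rightarrow> 'a pmf" where
  "two_point w u v \<equiv> map_pmf (\<lambda>c. if c then u else v) (bernoulli_pmf w)"

text \<open>Dividing by \<open>a1\<close> leaves one parameter, the ratio \<open>r\<close>.
  Replacing both values by their complements to 1 swaps \<open>small\<close> and
  \<open>large\<close> and maps each middle case to itself; the bounds for negated literals rest on
  this symmetry.\<close>

lemma simplify_cases:
  fixes a1 a2 b1 b2 r :: real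
  assumes pos: "0 < a1" "0 < a2" and frac: "fractional b1" "fractional b2"
    and r: "r = a2 / a1"
  obtains
    (small) "b1 + b2 * r \<le> 1" "b1 + b2 * r \<le> r"
      "simplify a1 a2 b1 b2
         = two_point (b2 * r / (b1 + b2 * r)) (0, b2 + b1 / r) (b1 + b2 * r, 0)"
  | (first_fixed) "1 < b1 + b2 * r" "b1 + b2 * r < r"
      "simplify a1 a2 b1 b2 = two_point b1 (1, b2 - (1 - b1) / r) (0, b2 + b1 / r)"
  | (second_fixed) "r < b1 + b2 * r" "b1 + b2 * r < 1"
      "simplify a1 a2 b1 b2 = two_point b2 (b1 - (1 - b2) * r, 1) (b1 + b2 * r, 0)"
  | (large) "1 \<le> b1 + b2 * r" "r \<le> b1 + b2 * r"
      "simplify a1 a2 b1 b2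
         = two_point ((1 - b2) * r / ((1 - b1) + (1 - b2) * r))
             (1, b2 - (1 - b1) / r) (b1 - (1 - b2) * r, 1)"
proof -
  let ?s = "a1 * b1 + a2 * b2"
  have s: "?s = a1 * (b1 + b2 * r)" and a2: "a2 = a1 * r"
    using pos r by (auto simp: field_simps)
  have le1: "?s \<le> a1 \<longleftrightarrow> b1 + b2 * r \<le> 1" and le2: "?s \<le> a2 \<longleftrightarrow> b1 + b2 * r \<le> r"
    using mult_le_cancel_left_pos[OF pos(1), of "b1 + b2 * r" 1]
      mult_le_cancel_left_pos[OF pos(1), of "b1 + b2 * r" r] unfolding s
    by (simp_all add: a2[symmetric])
  have le1': "a1 \<le> ?s \<longleftrightarrow> 1 \<le> b1 + b2 * r" and le2': "a2 \<le> ?s \<longleftrightarrow> r \<le> b1 + b2 * r"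
    using mult_le_cancel_left_pos[OF pos(1), of 1 "b1 + b2 * r"]
      mult_le_cancel_left_pos[OF pos(1), of r "b1 + b2 * r"] unfolding s
    by (simp_all add: a2[symmetric])
  have quot: "a2 * b2 / ?s = b2 * r / (b1 + b2 * r)"
    "a2 * (1 - b2) / (a1 * (1 - b1) + a2 * (1 - b2)) = (1 - b2) * r / ((1 - b1) + (1 - b2) * r)"
    "b1 * a1 / a2 = b1 / r" "(1 - b1) * a1 / a2 = (1 - b1) / r"
    "b2 * a2 / a1 = b2 * r" "(1 - b2) * a2 / a1 = (1 - b2) * r"
  proof -
    have "a1 * (1 - b1) + a2 * (1 - b2) = a1 * ((1 - b1) + (1 - b2) * r)"
      by (simp add: a2 algebra_simps)
    moreover have "a2 * b2 = a1 * (b2 * r)" "a2 * (1 - b2) = a1 * ((1 - b2) * r)"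
      by (simp_all add: a2)
    ultimately show "a2 * b2 / ?s = b2 * r / (b1 + b2 * r)"
      "a2 * (1 - b2) / (a1 * (1 - b1) + a2 * (1 - b2)) = (1 - b2) * r / ((1 - b1) + (1 - b2) * r)"
      unfolding s using pos by (metis mult_divide_mult_cancel_left order_less_irrefl)+
  qed (use pos r in simp_all)
  consider "?s \<le> a1" "?s \<le> a2" | "a1 < ?s" "?s < a2" | "a2 < ?s" "?s < a1"
    | "a1 \<le> ?s" "a2 \<le> ?s" "\<not> ?s \<le> min a1 a2"
    by linarith
  then show thesis
  proof cases
    case 1
    then show ?thesis
      using small le1 le2 by (simp add: simplify_def Let_def quot)
  next
    case 2
    moreover from this have "1 < b1 + b2 * r" "b1 + b2 * r < r"
      using le1 le2' by linarith+
    ultimately show ?thesis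
      using first_fixed by (simp add: simplify_def Let_def quot)
  next
    case 3
    moreover from this have "r < b1 + b2 * r" "b1 + b2 * r < 1"
      using le1' le2 by linarith+
    ultimately show ?thesis
      using second_fixed by (simp add: simplify_def Let_def quot)
  next
    case 4
    have "simplify a1 a2 b1 b2
         = two_point ((1 - b2) * r / ((1 - b1) + (1 - b2) * r))
             (1, b2 - (1 - b1) / r) (b1 - (1 - b2) * r, 1)"
      using 4 by (auto simp add: simplify_def Let_def quot)
    then show ?thesis
      using large 4 le1' le2' by blast
  qed
qed

lemma finite_set_simplify [simp]: "finite (set_pmf (simplify a1 a2 b1 b2))"
  by (simp add: simplify_def Let_def)

lemma simplify_unit_interval:
  assumes "0 < a1" "0 < a2" "fractional b1" "fractional b2"
    and gh: "(g, h) \<in> set_pmf (simplify a1 a2 b1 b2)"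
  shows "g \<in> {0..1}" "h \<in> {0..1}"
proof -
  define r where "r = a2 / a1"
  have r: "0 < r" and b: "0 < b1" "b1 < 1" "0 < b2" "b2 < 1"
    using assms by (auto simp: r_def fractional_def)
  have b': "0 < b1 / r" "0 < b2 * r" "0 < (1 - b1) / r" "0 < (1 - b2) * r"
    using r b by simp_all
  have lin: "(1 - b2) * r = r - b2 * r" "(1 - b1) / r = 1 / r - b1 / r"
    by (simp_all add: algebra_simps diff_divide_distrib)
  \<comment> \<open>The thresholds on the weighted sum say that the second coordinate stays at most
    1 when the first is set to 0, and at least 0 when the first is set to 1.\<close>
  have iff: "b2 + b1 / r \<le> 1 \<longleftrightarrow> b1 + b2 * r \<le> r" "(1 - b1) / r \<le> b2 \<longleftrightarrow> 1 \<le> b1 + b2 * r"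
    using r by (auto simp: field_simps)
  have "g \<in> {0..1} \<and> h \<in> {0..1}"
    by (rule simplify_cases[OF assms(1-4) r_def]; use gh b b' lin iff in \<open>auto split: if_splits\<close>)
  then show "g \<in> {0..1}" "h \<in> {0..1}" by auto
qed

lemma
  assumes "0 < a1" "0 < a2" "fractional b1" "fractional b2"
  shows expectation_fst_simplify: "measure_pmf.expectation (simplify a1 a2 b1 b2) fst = b1"
    and expectation_snd_simplify: "measure_pmf.expectation (simplify a1 a2 b1 b2) snd = b2"
proof -
  define r where "r = a2 / a1"
  have r: "0 < r" and b: "0 < b1" "b1 < 1" "0 < b2" "b2 < 1"
    using assms by (auto simp: r_def fractional_def)
  have p: "0 < b1 + b2 * r" "0 < (1 - b1) + (1 - b2) * r"
    using r b by (simp_all add: add_pos_pos)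
  have w: "b2 * r / (b1 + b2 * r) \<in> {0..1}" "(1 - b2) * r / ((1 - b1) + (1 - b2) * r) \<in> {0..1}"
    using r b p by (auto simp: divide_le_eq_1)
  have w': "1 - b2 * r / (b1 + b2 * r) = b1 / (b1 + b2 * r)"
    "1 - (1 - b2) * r / ((1 - b1) + (1 - b2) * r) = (1 - b1) / ((1 - b1) + (1 - b2) * r)"
    using p by (simp_all add: field_simps)
  have m: "(b2 + b1 / r) * (b2 * r / (b1 + b2 * r)) = b2"
  proof -
    have "(b2 + b1 / r) * (b2 * r) = b2 * (b1 + b2 * r)"
      using r by (simp add: field_simps)
    then show ?thesis
      using p(1) by (metis nonzero_mult_div_cancel_right order_less_irrefl times_divide_eq_right)
  qed
  \<comment> \<open>\<open>n1\<close> and \<open>n2\<close> are the two mean equations of case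
    \<open>large\<close>, multiplied by the common denominator of its probabilities.\<close>
  have n1: "(1 - b2) * r + (b1 - (1 - b2) * r) * (1 - b1) = b1 * ((1 - b1) + (1 - b2) * r)"
    by (simp add: algebra_simps)
  have n2: "(b2 - (1 - b1) / r) * ((1 - b2) * r) + (1 - b1) = b2 * ((1 - b1) + (1 - b2) * r)"
    using r by (simp add: field_simps)
  have "measure_pmf.expectation (simplify a1 a2 b1 b2) fst = b1
      \<and> measure_pmf.expectation (simplify a1 a2 b1 b2) snd = b2"
  proof (rule simplify_cases[OF assms r_def], goal_cases)
    case 1
    then show ?case using w p m by (simp add: w')
  next
    case 2
    then show ?case using b by (simp add: algebra_simps diff_divide_distrib)
  next
    case 3
    then show ?case using b by (simp add: algebra_simps)
  next
    case 4
    let ?d = "(1 - b1) + (1 - b2) * r"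
    have "(1 - b2) * r / ?d + (b1 - (1 - b2) * r) * ((1 - b1) / ?d) = b1"
      "(b2 - (1 - b1) / r) * ((1 - b2) * r / ?d) + (1 - b1) / ?d = b2"
      using p(2) n1 n2
      by (metis add_divide_distrib nonzero_mult_div_cancel_right order_less_irrefl times_divide_eq_right)+
    then show ?case using w 4(3) by (simp add: w'(2))
  qed
  then show "measure_pmf.expectation (simplify a1 a2 b1 b2) fst = b1"
    and "measure_pmf.expectation (simplify a1 a2 b1 b2) snd = b2" by auto
qed

section \<open>Expected drop of the potential of the carry\<close>

text \<open>Quadratic potential of the carry; the cut-off makes it vanish once the carry is fixed.\<close>

definition drift_potential :: "real \<Rightarrow> real" where
  "drift_potential z = (if fractional z then z * (8 / 7 - z) else 0)"

lemma drift_potential_0 [simp]: "drift_potential 0 = 0" "drift_potential 1 = 0"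
  by (simp_all add: drift_potential_def fractional_def)

lemma drift_potential_le: "z \<in> {0..1} \<Longrightarrow> drift_potential z \<le> z * (8 / 7 - z)"
  by (auto simp: drift_potential_def fractional_def)

text \<open>The rate on the left is the one that the factor \<open>2 / \<alpha> ^ 3\<close> turns
  into \<open>1 / \<alpha> - 1\<close>. It is at most \<alpha> / 8, so the surplus 1/7 of 8/7 over 1
  can pay for it.\<close>

lemma drift_rate_le:
  fixes \<alpha> :: real
  assumes "0 < \<alpha>" "\<alpha> \<le> 1 / 2"
  shows "\<alpha>\<^sup>2 * (1 - \<alpha>) / 2 \<le> \<alpha> / 7"
proof -
  have "0 \<le> (\<alpha> - 1 / 2)\<^sup>2" by simp
  then have "\<alpha> * (1 - \<alpha>) \<le> 1 / 4"
    by (simp add: power2_eq_square algebra_simps)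
  then have "\<alpha> * (\<alpha> * (1 - \<alpha>)) \<le> \<alpha> * (1 / 4)"
    using assms by (intro mult_left_mono) auto
  then show ?thesis using assms by (simp add: power2_eq_square algebra_simps)
qed

text \<open>The carry becomes 0 or 1, so the potential vanishes after the step; as z is below 1, the
  factor \<open>8 / 7 - z\<close> exceeds 1/7 and covers the rate.\<close>

lemma drift_first_fixed:
  fixes \<alpha> z :: real
  assumes "0 < \<alpha>" "\<alpha> \<le> 1 / 2" "0 < z" "z < 1"
  shows "0 \<le> z * (8 / 7 - z) - \<alpha>\<^sup>2 * (1 - \<alpha>) / 2 * z"
proof -
  have "0 \<le> z * (8 / 7 - z - \<alpha>\<^sup>2 * (1 - \<alpha>) / 2)"
    using drift_rate_le[OF assms(1,2)] assms by (intro mult_nonneg_nonneg) auto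
  then show ?thesis by (simp add: algebra_simps)
qed

text \<open>The literal grows to \<open>z + e * r\<close> or drops to 0. The probability of growth
  cancels against the first factor of the potential, so what counts is the decrease of
  \<open>8 / 7 - z\<close> by \<open>e * r\<close>, which is at least \<alpha> / 2.\<close>

lemma drift_small:
  fixes \<alpha> z e r :: real
  assumes "0 < \<alpha>" "\<alpha> \<le> 1 / 2" "0 < z" "\<alpha> \<le> e" "1 / 2 \<le> r" "z + e * r \<le> 1"
  shows "z / (z + e * r) * drift_potential (z + e * r)
    \<le> z * (8 / 7 - z) - \<alpha>\<^sup>2 * (1 - \<alpha>) / 2 * z"
proof -
  have er: "\<alpha> * (1 / 2) \<le> e * r" using assms by (intro mult_mono) auto
  then have pos: "0 < z + e * r" using assms by linarith
  have "z / (z + e * r) * drift_potential (z + e * r)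
      \<le> z / (z + e * r) * ((z + e * r) * (8 / 7 - (z + e * r)))"
    using assms pos by (intro mult_left_mono drift_potential_le) auto
  also have "\<dots> = z * (8 / 7 - z - e * r)" using pos by simp
  also have "\<dots> \<le> z * (8 / 7 - z - \<alpha>\<^sup>2 * (1 - \<alpha>) / 2)"
    using er drift_rate_le[OF assms(1,2)] assms by (intro mult_left_mono) auto
  finally show ?thesis by (simp add: algebra_simps)
qed

text \<open>The literal moves to one of two points with mean z, so the concave quadratic loses
  exactly the variance \<open>q * (1 - q) * r\<^sup>2\<close>.\<close>

lemma drift_second_fixed:
  fixes \<alpha> z q r :: real
  assumes \<alpha>: "0 < \<alpha>" "\<alpha> \<le> 1 / 2" and z: "0 < z" "z < 1" and q: "\<alpha> \<le> q" "q \<le> 1 - \<alpha>"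
    and r: "1 / 2 \<le> r" and "r < z + q * r" "z + q * r < 1"
  shows "drift_potential (z - (1 - q) * r) * q + drift_potential (z + q * r) * (1 - q)
    \<le> z * (8 / 7 - z) - \<alpha>\<^sup>2 * (1 - \<alpha>) / 2 * z"
proof -
  have range: "z - (1 - q) * r \<in> {0..1}" "z + q * r \<in> {0..1}"
    using assms mult_nonneg_nonneg[of q r] mult_nonneg_nonneg[of "1 - q" r]
    by (auto simp: algebra_simps)
  have "drift_potential (z - (1 - q) * r) * q + drift_potential (z + q * r) * (1 - q)
      \<le> (z - (1 - q) * r) * (8 / 7 - (z - (1 - q) * r)) * q + (z + q * r) * (8 / 7 - (z + q * r)) * (1 - q)"
    using range \<alpha> q by (intro add_mono mult_right_mono drift_potential_le) auto
  also have "\<dots> = z * (8 / 7 - z) - q * (1 - q) * r\<^sup>2"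
    by (simp add: field_simps power2_eq_square)
  finally have upper: "drift_potential (z - (1 - q) * r) * q + drift_potential (z + q * r) * (1 - q)
      \<le> z * (8 / 7 - z) - q * (1 - q) * r\<^sup>2" .
  \<comment> \<open>Concavity: between \<alpha> and 1 - \<alpha> the product
    \<open>q * (1 - q)\<close> is smallest at the ends.\<close>
  have "0 \<le> (q - \<alpha>) * (1 - \<alpha> - q)" using q by (intro mult_nonneg_nonneg) auto
  then have "\<alpha> * (1 - \<alpha>) \<le> q * (1 - q)" by (simp add: algebra_simps)
  moreover have "(1 / 2)\<^sup>2 \<le> r\<^sup>2" using r by (intro power_mono) auto
  ultimately have "\<alpha> * (1 - \<alpha>) * (1 / 2)\<^sup>2 \<le> q * (1 - q) * r\<^sup>2"
    by (rule mult_mono) (use \<alpha> q in auto)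
  moreover have "\<alpha>\<^sup>2 * (1 - \<alpha>) / 2 * z \<le> \<alpha> * (1 - \<alpha>) * (1 / 2)\<^sup>2"
  proof -
    have "\<alpha> * z \<le> (1 / 2) * 1" using \<alpha> z by (intro mult_mono) auto
    then have "(\<alpha> * (1 - \<alpha>) / 2) * (\<alpha> * z) \<le> (\<alpha> * (1 - \<alpha>) / 2) * (1 / 2)"
      using \<alpha> by (intro mult_left_mono) auto
    then show ?thesis by (simp add: power2_eq_square algebra_simps)
  qed
  ultimately show ?thesis using upper by linarith
qed

text \<open>The literal jumps to 1 or falls to \<open>z - e * r\<close>. The case condition makes
  the jump at least as likely as \<open>e\<close>, hence as \<alpha>, and at 1 the cut-off removes
  the 1/7 left in the quadratic. This yields a drop of \<alpha> / 7 even for z close to 1, which is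
  what 8/7 in place of 1 achieves.\<close>

lemma drift_large:
  fixes \<alpha> z e r :: real
  assumes \<alpha>: "0 < \<alpha>" "\<alpha> \<le> 1 / 2" and z: "0 < z" "z < 1" and e: "\<alpha> \<le> e" "e \<le> 1 - \<alpha>"
    and r: "0 < r" and "1 \<le> z + (1 - e) * r" "r \<le> z + (1 - e) * r"
  shows "(1 - z) / ((1 - z) + e * r) * drift_potential (z - e * r)
    \<le> z * (8 / 7 - z) - \<alpha>\<^sup>2 * (1 - \<alpha>) / 2 * z"
proof -
  let ?d = "(1 - z) + e * r"
  have er: "0 < e * r" using \<alpha> e r by simp
  have dist: "(1 - e) * r = r - e * r" by (simp add: algebra_simps)
  have d: "0 < ?d" "?d \<le> r" using assms er dist by linarith+
  have "e \<le> e * r / ?d"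
    using d \<alpha> e by (simp add: le_divide_eq mult_left_mono)
  have range: "z - e * r \<in> {0..1}" using assms er dist
    unfolding atLeastAtMost_iff by linarith
  have "(1 - z) / ?d * drift_potential (z - e * r)
      \<le> (1 - z) / ?d * ((z - e * r) * (8 / 7 - (z - e * r)))"
    using range d z by (intro mult_left_mono drift_potential_le) auto
  \<comment> \<open>The last term is 1/7 times the probability of the jump to 1.\<close>
  also have "\<dots> = z * (8 / 7 - z) - (1 - z) * (e * r) - e * r / ?d / 7"
    using d by (simp add: divide_simps) (simp add: algebra_simps)
  also have "\<dots> \<le> z * (8 / 7 - z) - \<alpha> / 7"
  proof -
    have le: "x - y - w / 7 \<le> x - \<alpha> / 7" if "0 \<le> y" "\<alpha> \<le> w" for x y w :: real
      using that by simp
    have "0 \<le> (1 - z) * (e * r)" using er z by simp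
    then show ?thesis
      using order_trans[OF e(1) \<open>e \<le> e * r / ?d\<close>] by (rule le)
  qed
  also have "\<dots> \<le> z * (8 / 7 - z) - \<alpha>\<^sup>2 * (1 - \<alpha>) / 2 * z"
  proof -
    have "\<alpha>\<^sup>2 * (1 - \<alpha>) / 2 * z \<le> \<alpha>\<^sup>2 * (1 - \<alpha>) / 2 * 1"
      using \<alpha> z by (intro mult_left_mono) auto
    then show ?thesis using drift_rate_le[OF \<alpha>] by linarith
  qed
  finally show ?thesis .
qed

text \<open>Only the value \<open>b2\<close> of the partner is kept away from 0 and 1; the carry may
  be arbitrarily close to either. A negated literal is the same step seen from
  \<open>1 - b1\<close>, so \<open>drift_small\<close> for one form is paired with
  \<open>drift_large\<close> for the other.\<close>

lemma
  fixes \<alpha> :: real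
  assumes a: "0 < a1" "0 < a2" "a1 \<le> 2 * a2" and frac: "fractional b1"
    and \<alpha>: "0 < \<alpha>" "\<alpha> \<le> 1 / 2" and b2: "\<alpha> \<le> b2" "b2 \<le> 1 - \<alpha>"
  shows simplify_drift: "measure_pmf.expectation (simplify a1 a2 b1 b2) (\<lambda>z. drift_potential (fst z))
      \<le> b1 * (8 / 7 - b1) - \<alpha>\<^sup>2 * (1 - \<alpha>) / 2 * b1" (is ?t1)
    and simplify_drift_compl:
      "measure_pmf.expectation (simplify a1 a2 b1 b2) (\<lambda>z. drift_potential (1 - fst z))
      \<le> (1 - b1) * (8 / 7 - (1 - b1)) - \<alpha>\<^sup>2 * (1 - \<alpha>) / 2 * (1 - b1)" (is ?t2)
proof -
  define r where "r = a2 / a1"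
  have r: "0 < r" "1 / 2 \<le> r" and b: "0 < b1" "b1 < 1" "0 < b2" "b2 < 1"
    using assms by (auto simp: r_def fractional_def field_simps)
  have fb2: "fractional b2" using b by (simp add: fractional_def)
  have p: "0 < b1 + b2 * r" "0 < (1 - b1) + (1 - b2) * r"
    using r b by (simp_all add: add_pos_pos)
  have w: "b2 * r / (b1 + b2 * r) \<in> {0..1}" "(1 - b2) * r / ((1 - b1) + (1 - b2) * r) \<in> {0..1}"
    using r b p by (auto simp: divide_le_eq_1)
  have w': "1 - b2 * r / (b1 + b2 * r) = b1 / (b1 + b2 * r)"
    "1 - (1 - b2) * r / ((1 - b1) + (1 - b2) * r) = (1 - b1) / ((1 - b1) + (1 - b2) * r)"
    using p by (simp_all add: field_simps)
  have dist: "(1 - b2) * r = r - b2 * r"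
    by (simp add: algebra_simps)
  have "?t1 \<and> ?t2"
  proof (rule simplify_cases[OF a(1,2) frac fb2 r_def], goal_cases)
    case 1
    have "b1 / (b1 + b2 * r) * drift_potential (b1 + b2 * r)
        \<le> b1 * (8 / 7 - b1) - \<alpha>\<^sup>2 * (1 - \<alpha>) / 2 * b1"
      using 1 \<alpha> b b2 r by (intro drift_small) auto
    moreover have "(1 - (1 - b1)) / (1 - (1 - b1) + b2 * r) * drift_potential ((1 - b1) - b2 * r)
        \<le> (1 - b1) * (8 / 7 - (1 - b1)) - \<alpha>\<^sup>2 * (1 - \<alpha>) / 2 * (1 - b1)"
      using 1 \<alpha> b b2 r dist by (intro drift_large) auto
    moreover have compl: "1 - (b1 + b2 * r) = (1 - b1) - b2 * r" "1 - (1 - b1) = b1"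
      by simp_all
    ultimately show ?case
      using 1(3) w(1) by (simp only: integral_map_pmf integral_bernoulli_pmf atLeastAtMost_iff w')
        (simp add: mult.commute compl)
  next
    case 2
    then show ?case using b drift_first_fixed[OF \<alpha>, of b1] drift_first_fixed[OF \<alpha>, of "1 - b1"] by simp
  next
    case 3
    have "drift_potential (b1 - (1 - b2) * r) * b2 + drift_potential (b1 + b2 * r) * (1 - b2)
        \<le> b1 * (8 / 7 - b1) - \<alpha>\<^sup>2 * (1 - \<alpha>) / 2 * b1"
      using 3 \<alpha> b b2 r by (intro drift_second_fixed) auto
    moreover have "drift_potential ((1 - b1) - (1 - (1 - b2)) * r) * (1 - b2)
          + drift_potential ((1 - b1) + (1 - b2) * r) * (1 - (1 - b2))
        \<le> (1 - b1) * (8 / 7 - (1 - b1)) - \<alpha>\<^sup>2 * (1 - \<alpha>) / 2 * (1 - b1)"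
      using 3 \<alpha> b b2 r dist by (intro drift_second_fixed) auto
    moreover have "1 - (b1 - (1 - b2) * r) = (1 - b1) + (1 - b2) * r"
      "1 - (b1 + b2 * r) = (1 - b1) - b2 * r" "1 - (1 - b2) = b2"
      by simp_all
    ultimately show ?case
      using 3(3) b(3,4) by (simp only: integral_map_pmf integral_bernoulli_pmf if_True if_False
          fst_conv less_imp_le) (simp add: add.commute)
  next
    case 4
    have "(1 - b1) / (1 - b1 + (1 - b2) * r) * drift_potential (b1 - (1 - b2) * r)
        \<le> b1 * (8 / 7 - b1) - \<alpha>\<^sup>2 * (1 - \<alpha>) / 2 * b1"
      using 4 \<alpha> b b2 r by (intro drift_large) auto
    moreover have "(1 - b1) / (1 - b1 + (1 - b2) * r) * drift_potential (1 - b1 + (1 - b2) * r)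
        \<le> (1 - b1) * (8 / 7 - (1 - b1)) - \<alpha>\<^sup>2 * (1 - \<alpha>) / 2 * (1 - b1)"
      using 4 \<alpha> b b2 r dist by (intro drift_small) auto
    moreover have compl: "1 - (b1 - r * (1 - b2)) = (1 - b1) + r * (1 - b2)"
      by simp
    ultimately show ?case
      using 4(3) w(2) by (simp only: integral_map_pmf integral_bernoulli_pmf atLeastAtMost_iff w')
        (simp add: mult.commute compl)
  qed
  then show ?t1 ?t2 by auto
qed

section \<open>The loop and its average over random orders\<close>

lemma finite_set_dep_round_loop [simp]: "finite (set_pmf (dep_round_loop a \<pi> X))"
proof (induction a \<pi> X rule: dep_round_loop.induct)
  case (1 a \<pi> X)
  show ?case
    by (subst dep_round_loop.simps) (auto split: list.split intro!: "1.IH")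
qed

text \<open>Only \<open>i\<close> and \<open>j\<close> change, and both were fractional before, so
  no index becomes newly fractional: the new list depends on \<open>i # j # ks\<close>
  alone.\<close>

lemma filter_fractional_update:
  assumes "filter (\<lambda>k. fractional (X k)) (remdups \<pi>) = i # j # ks"
  shows "filter (\<lambda>k. fractional ((X(i := g, j := h)) k)) (remdups \<pi>)
    = filter (\<lambda>k. fractional ((X(i := g, j := h)) k)) (i # j # ks)"
proof -
  have "fractional (X i)" "fractional (X j)"
    using arg_cong[OF assms, of set] by auto
  then have "fractional ((X(i := g, j := h)) k) \<and> fractional (X k)
      \<longleftrightarrow> fractional ((X(i := g, j := h)) k)" for k
    by auto
  then show ?thesis
    unfolding assms[symmetric] filter_filter by (intro filter_cong refl) blast
qed

text \<open>The loop sees \<pi> only through the ordered list of its fractional indices. This allows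
  settled indices to be deleted from \<pi>.\<close>

lemma dep_round_loop_cong:
  assumes "filter (\<lambda>k. fractional (X k)) (remdups \<pi>)
    = filter (\<lambda>k. fractional (X k)) (remdups \<pi>')"
  shows "dep_round_loop a \<pi> X = dep_round_loop a \<pi>' X"
  using assms
proof (induction a \<pi> X rule: dep_round_loop.induct)
  case (1 a \<pi> X)
  show ?case
  proof (cases "\<exists>i j ks. filter (\<lambda>k. fractional (X k)) (remdups \<pi>) = i # j # ks")
    case True
    then obtain i j ks where ks: "filter (\<lambda>k. fractional (X k)) (remdups \<pi>) = i # j # ks"
      by blast
    then have ks': "filter (\<lambda>k. fractional (X k)) (remdups \<pi>') = i # j # ks"
      using "1.prems" by simp
    have eq: "dep_round_loop a \<pi> (X(i := g, j := h)) = dep_round_loop a \<pi>' (X(i := g, j := h))"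
      if "(g, h) \<in> set_pmf (simplify (a i) (a j) (X i) (X j))" for g h
      using filter_fractional_update[OF ks] filter_fractional_update[OF ks']
      by (intro "1.IH"[OF ks refl that refl]) (rule trans, assumption, rule sym)
    show ?thesis
      unfolding dep_round_loop.simps[of a \<pi> X] dep_round_loop.simps[of a \<pi>' X]
      using ks ks' eq by (auto intro!: bind_pmf_cong)
  next
    case False
    then show ?thesis
      unfolding dep_round_loop.simps[of a \<pi> X] dep_round_loop.simps[of a \<pi>' X]
      using "1.prems" by (auto split: list.split)
  qed
qed

lemma dep_round_loop_unchanged:
  assumes "Y \<in> set_pmf (dep_round_loop a \<pi> X)" "k \<notin> set \<pi> \<or> \<not> fractional (X k)"
  shows "Y k = X k"
  using assms
proof (induction a \<pi> X rule: dep_round_loop.induct)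
  case (1 a \<pi> X)
  show ?case
  proof (cases "\<exists>i j ks. filter (\<lambda>k. fractional (X k)) (remdups \<pi>) = i # j # ks")
    case True
    then obtain i j ks where ks: "filter (\<lambda>k. fractional (X k)) (remdups \<pi>) = i # j # ks"
      by blast
    have "i \<in> {k \<in> set \<pi>. fractional (X k)}" "j \<in> {k \<in> set \<pi>. fractional (X k)}"
      using arg_cong[OF ks, of set] by auto
    then have "k \<noteq> i" "k \<noteq> j" using "1.prems"(2) by auto
    moreover obtain g h where gh: "(g, h) \<in> set_pmf (simplify (a i) (a j) (X i) (X j))"
      "Y \<in> set_pmf (dep_round_loop a \<pi> (X(i := g, j := h)))"
      using "1.prems"(1) ks by (subst (asm) dep_round_loop.simps) auto
    ultimately have "k \<notin> set \<pi> \<or> \<not> fractional ((X(i := g, j := h)) k)"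
      using "1.prems"(2) by simp
    then have "Y k = (X(i := g, j := h)) k"
      by (rule "1.IH"[OF ks refl gh(1) refl gh(2)])
    then show ?thesis using \<open>k \<noteq> i\<close> \<open>k \<noteq> j\<close> by simp
  next
    case False
    then show ?thesis
      using "1.prems"(1) by (subst (asm) dep_round_loop.simps) (auto split: list.splits)
  qed
qed

lemma expectation_pmf_mono:
  fixes g h :: "'b \<Rightarrow> real"
  assumes "finite (set_pmf M)" "\<And>z. z \<in> set_pmf M \<Longrightarrow> g z \<le> h z"
  shows "measure_pmf.expectation M g \<le> measure_pmf.expectation M h"
  using assms by (intro integral_mono_AE) (auto simp: AE_measure_pmf_iff integrable_measure_pmf_finite)

text \<open>The product runs over \<pi> only, so that a settled index can leave the list while its
  constant factor leaves the expectation.\<close>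

definition loop_value ::
    "(nat \<Rightarrow> real) \<Rightarrow> (nat \<Rightarrow> real \<Rightarrow> real) \<Rightarrow> nat list \<Rightarrow> (nat \<Rightarrow> real) \<Rightarrow> real" where
  "loop_value a f \<pi> X
     = measure_pmf.expectation (dep_round_loop a \<pi> X) (\<lambda>Y. \<Prod>k\<in>set \<pi>. f k (Y k))"

lemma loop_value_remove:
  assumes "distinct \<pi>" "k \<in> set \<pi>" "\<not> fractional (X k)"
  shows "loop_value a f \<pi> X = f k (X k) * loop_value a f (filter (\<lambda>i. i \<noteq> k) \<pi>) X"
proof -
  let ?\<pi> = "filter (\<lambda>i. i \<noteq> k) \<pi>"
  have "filter (\<lambda>i. fractional (X i)) \<pi> = filter (\<lambda>i. fractional (X i)) ?\<pi>"
    using assms(3) by (auto simp: filter_filter intro!: filter_cong)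
  then have "dep_round_loop a \<pi> X = dep_round_loop a ?\<pi> X"
    using assms(1) by (intro dep_round_loop_cong) (simp add: distinct_remdups_id)
  then have "loop_value a f \<pi> X
      = measure_pmf.expectation (dep_round_loop a ?\<pi> X) (\<lambda>Y. \<Prod>i\<in>set \<pi>. f i (Y i))"
    by (simp add: loop_value_def)
  also have "\<dots> = measure_pmf.expectation (dep_round_loop a ?\<pi> X)
      (\<lambda>Y. f k (X k) * (\<Prod>i\<in>set ?\<pi>. f i (Y i)))"
  proof (intro integral_cong_AE; (simp add: AE_measure_pmf_iff)?)
    show "\<forall>Y\<in>set_pmf (dep_round_loop a ?\<pi> X).
        (\<Prod>i\<in>set \<pi>. f i (Y i)) = f k (X k) * (\<Prod>i\<in>{x \<in> set \<pi>. x \<noteq> k}. f i (Y i))"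
    proof
      fix Y assume "Y \<in> set_pmf (dep_round_loop a ?\<pi> X)"
      then have "Y k = X k" using assms(3) by (rule dep_round_loop_unchanged[OF _ disjI2])
      moreover have "{x \<in> set \<pi>. x \<noteq> k} = set \<pi> - {k}" by auto
      ultimately show "(\<Prod>i\<in>set \<pi>. f i (Y i))
          = f k (X k) * (\<Prod>i\<in>{x \<in> set \<pi>. x \<noteq> k}. f i (Y i))"
        using assms(2) by (simp add: prod.remove[of _ k])
    qed
  qed
  finally show ?thesis by (simp add: loop_value_def)
qed

lemma loop_value_Cons_integral:
  assumes "distinct (c # xs)" "\<not> fractional (X c)"
  shows "loop_value a f (c # xs) X = f c (X c) * loop_value a f xs X"
proof -
  have "filter (\<lambda>i. i \<noteq> c) (c # xs) = xs" using assms(1) by (auto intro: filter_True)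
  then show ?thesis using loop_value_remove[OF assms(1), of c X a f] assms(2) by simp
qed

lemma loop_value_single: "loop_value a f [c] X = f c (X c)"
  by (auto simp: loop_value_def dep_round_loop.simps[of a "[c]" X])

lemma expectation_bind_finite:
  fixes h :: "'b \<Rightarrow> real"
  assumes "finite (set_pmf M)" "\<And>x. x \<in> set_pmf M \<Longrightarrow> finite (set_pmf (F x))"
  shows "measure_pmf.expectation (bind_pmf M F) h
    = measure_pmf.expectation M (\<lambda>x. measure_pmf.expectation (F x) h)"
  using assms by (simp add: pmf_expectation_bind[of "set_pmf M"] integral_measure_pmf[of "set_pmf M"])

text \<open>The carry stays at the head. If \<open>c\<close> is still fractional, \<open>j\<close>
  is settled and removed; otherwise \<open>c\<close> is removed and \<open>j\<close> takes over,
  possibly settled itself.\<close>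

lemma loop_value_step:
  assumes dist: "distinct (c # j # xs)" and frac: "fractional (X c)" "fractional (X j)"
  shows "loop_value a f (c # j # xs) X
    = measure_pmf.expectation (simplify (a c) (a j) (X c) (X j)) (\<lambda>z.
        if fractional (fst z) then f j (snd z) * loop_value a f (c # xs) (X(c := fst z, j := snd z))
        else f c (fst z) * loop_value a f (j # xs) (X(c := fst z, j := snd z)))"
proof -
  have "filter (\<lambda>k. fractional (X k)) (remdups (c # j # xs))
      = c # j # filter (\<lambda>k. fractional (X k)) xs"
    using dist frac by (simp add: distinct_remdups_id)
  then have "dep_round_loop a (c # j # xs) X = bind_pmf (simplify (a c) (a j) (X c) (X j))
      (\<lambda>(g, h). dep_round_loop a (c # j # xs) (X(c := g, j := h)))"
    by (subst dep_round_loop.simps) simp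
  then have "loop_value a f (c # j # xs) X
      = measure_pmf.expectation (simplify (a c) (a j) (X c) (X j))
          (\<lambda>z. loop_value a f (c # j # xs) (X(c := fst z, j := snd z)))"
    unfolding loop_value_def by (simp add: expectation_bind_finite case_prod_unfold)
  also have "\<dots> = measure_pmf.expectation (simplify (a c) (a j) (X c) (X j)) (\<lambda>z.
        if fractional (fst z) then f j (snd z) * loop_value a f (c # xs) (X(c := fst z, j := snd z))
        else f c (fst z) * loop_value a f (j # xs) (X(c := fst z, j := snd z)))"
  proof (intro integral_cong_AE; (simp add: AE_measure_pmf_iff del: fun_upd_apply)?; intro ballI)
    fix z assume z: "z \<in> set_pmf (simplify (a c) (a j) (X c) (X j))"
    let ?X = "X(c := fst z, j := snd z)"
    have vals: "?X c = fst z" "?X j = snd z" using dist by auto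
    have filt: "filter (\<lambda>i. i \<noteq> c) (c # j # xs) = j # xs"
      "filter (\<lambda>i. i \<noteq> j) (c # j # xs) = c # xs"
      using dist by (auto intro: filter_True)
    have "fst z \<in> {0, 1} \<or> snd z \<in> {0, 1}"
      using z simplify_fixes_one[of "fst z" "snd z" "a c" "a j" "X c" "X j"] by simp
    then have "\<not> fractional (snd z)" if "fractional (fst z)"
      using that by (auto simp: fractional_def)
    then show "(fractional (fst z) \<longrightarrow> loop_value a f (c # j # xs) ?X
          = f j (snd z) * loop_value a f (c # xs) ?X)
      \<and> (\<not> fractional (fst z) \<longrightarrow> loop_value a f (c # j # xs) ?X
          = f c (fst z) * loop_value a f (j # xs) ?X)"
      using loop_value_remove[OF dist, of c ?X a f] loop_value_remove[OF dist, of j ?X a f]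
      unfolding filt vals by simp
  qed
  finally show ?thesis .
qed

section \<open>Averaging over the order of the untouched indices\<close>

lemma sum_permutations_of_set:
  assumes "finite R" "R \<noteq> {}"
  shows "(\<Sum>xs\<in>permutations_of_set R. F xs)
    = (\<Sum>j\<in>R. \<Sum>ys\<in>permutations_of_set (R - {j}). F (j # ys))"
  unfolding permutations_of_set_nonempty[OF assms(2)]
  using assms(1) by (subst sum.UNION_disjoint) (auto simp: sum.reindex inj_on_def)

text \<open>The conditional expectation given that \<open>c\<close> heads the list and the order of
  the untouched set \<open>R\<close> is still uniform.\<close>

definition average_value ::
    "(nat \<Rightarrow> real) \<Rightarrow> (nat \<Rightarrow> real \<Rightarrow> real) \<Rightarrow> nat \<Rightarrow> nat set \<Rightarrow> (nat \<Rightarrow> real) \<Rightarrow> real" where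
  "average_value a f c R X
     = (\<Sum>xs\<in>permutations_of_set R. loop_value a f (c # xs) X) / fact (card R)"

lemma average_value_empty [simp]: "average_value a f c {} X = f c (X c)"
  by (simp add: average_value_def loop_value_single)

lemma sum_permutations_average:
  assumes "finite R" "R \<noteq> {}"
  shows "(\<Sum>xs\<in>permutations_of_set R. loop_value a f xs X) / fact (card R)
    = (\<Sum>j\<in>R. average_value a f j (R - {j}) X) / card R"
proof -
  have "(\<Sum>xs\<in>permutations_of_set R. loop_value a f xs X)
      = (\<Sum>j\<in>R. fact (card R - 1) * average_value a f j (R - {j}) X)"
    using assms by (simp add: sum_permutations_of_set average_value_def)
  moreover have "(fact (card R) :: real) = card R * fact (card R - 1)"
    using assms by (simp add: fact_reduce card_gt_0_iff)
  ultimately show ?thesis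
    by (simp add: sum_distrib_left[symmetric])
qed

text \<open>A settled carry contributes only its factor; the first index of the uniform order then
  starts as a new carry.\<close>

lemma average_value_integral:
  assumes "finite R" "R \<noteq> {}" "c \<notin> R" "\<not> fractional (X c)"
  shows "average_value a f c R X
    = f c (X c) * ((\<Sum>j\<in>R. average_value a f j (R - {j}) X) / card R)"
proof -
  have "average_value a f c R X
      = (\<Sum>xs\<in>permutations_of_set R. f c (X c) * loop_value a f xs X) / fact (card R)"
    unfolding average_value_def using assms(3,4)
    by (intro arg_cong2[where f = "(/)"] sum.cong refl loop_value_Cons_integral)
      (auto dest: permutations_of_setD)
  then show ?thesis
    unfolding sum_distrib_left[symmetric] times_divide_eq_right[symmetric]
      sum_permutations_average[OF assms(1,2)] .
qed

lemma average_value_step: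
  assumes "finite R" "R \<noteq> {}" "c \<notin> R" "fractional (X c)" "\<And>j. j \<in> R \<Longrightarrow> fractional (X j)"
  shows "average_value a f c R X
    = (\<Sum>j\<in>R. measure_pmf.expectation (simplify (a c) (a j) (X c) (X j)) (\<lambda>z.
        if fractional (fst z)
        then f j (snd z) * average_value a f c (R - {j}) (X(c := fst z, j := snd z))
        else f c (fst z) * average_value a f j (R - {j}) (X(c := fst z, j := snd z)))) / card R"
proof -
  let ?S = "\<lambda>j. simplify (a c) (a j) (X c) (X j)"
  let ?L = "\<lambda>j ys z. if fractional (fst z)
      then f j (snd z) * loop_value a f (c # ys) (X(c := fst z, j := snd z))
      else f c (fst z) * loop_value a f (j # ys) (X(c := fst z, j := snd z))"
  let ?A = "\<lambda>j z. if fractional (fst z)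
      then f j (snd z) * average_value a f c (R - {j}) (X(c := fst z, j := snd z))
      else f c (fst z) * average_value a f j (R - {j}) (X(c := fst z, j := snd z))"
  have "(\<Sum>xs\<in>permutations_of_set R. loop_value a f (c # xs) X)
      = (\<Sum>j\<in>R. \<Sum>ys\<in>permutations_of_set (R - {j}). loop_value a f (c # j # ys) X)"
    using assms(1,2) by (rule sum_permutations_of_set)
  also have "\<dots> = (\<Sum>j\<in>R. \<Sum>ys\<in>permutations_of_set (R - {j}).
      measure_pmf.expectation (?S j) (?L j ys))"
    using assms(3-5)
    by (intro sum.cong refl loop_value_step) (auto dest: permutations_of_setD)
  also have "\<dots> = (\<Sum>j\<in>R. measure_pmf.expectation (?S j)
      (\<lambda>z. \<Sum>ys\<in>permutations_of_set (R - {j}). ?L j ys z))"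
    by (intro sum.cong refl Bochner_Integration.integral_sum[symmetric] integrable_measure_pmf_finite)
      simp
  also have "\<dots> = (\<Sum>j\<in>R. measure_pmf.expectation (?S j) (\<lambda>z. fact (card R - 1) * ?A j z))"
  proof (intro sum.cong refl Bochner_Integration.integral_cong)
    fix j z assume "j \<in> R"
    then have "card (R - {j}) = card R - 1" using assms(1) by simp
    then show "(\<Sum>ys\<in>permutations_of_set (R - {j}). ?L j ys z) = fact (card R - 1) * ?A j z"
      by (simp add: average_value_def sum_distrib_left[symmetric])
  qed
  also have "\<dots> = fact (card R - 1) * (\<Sum>j\<in>R. measure_pmf.expectation (?S j) (?A j))"
    by (simp add: sum_distrib_left)
  finally have "(\<Sum>xs\<in>permutations_of_set R. loop_value a f (c # xs) X)
      = fact (card R - 1) * (\<Sum>j\<in>R. measure_pmf.expectation (?S j) (?A j))" .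
  moreover have "(fact (card R) :: real) = card R * fact (card R - 1)"
    using assms by (simp add: fact_reduce card_gt_0_iff)
  ultimately show ?thesis by (simp add: average_value_def)
qed

lemma expectation_dep_round:
  assumes "1 \<le> n"
  shows "measure_pmf.expectation (dep_round n p a) (\<lambda>Y. \<Prod>k\<in>{1..n}. f k (Y k))
    = (\<Sum>j\<in>{1..n}. average_value a f j ({1..n} - {j}) p) / n"
proof -
  have "measure_pmf.expectation (dep_round n p a) (\<lambda>Y. \<Prod>k\<in>{1..n}. f k (Y k))
      = (\<Sum>xs\<in>permutations_of_set {1..n}. measure_pmf.expectation (dep_round_loop a xs p)
          (\<lambda>Y. \<Prod>k\<in>{1..n}. f k (Y k))) / fact n"
    by (simp add: dep_round_def expectation_bind_finite integral_pmf_of_set)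
  also have "\<dots> = (\<Sum>xs\<in>permutations_of_set {1..n}. loop_value a f xs p) / fact (card {1..n})"
    by (intro arg_cong2[where f = "(/)"] sum.cong) (auto simp: loop_value_def dest: permutations_of_setD)
  also have "\<dots> = (\<Sum>j\<in>{1..n}. average_value a f j ({1..n} - {j}) p) / n"
    using assms by (subst sum_permutations_average) auto
  finally show ?thesis .
qed

section \<open>Potential of the carry\<close>

text \<open>The value 1 outside both sets lets a single product over all indices represent the
  product in question.\<close>

definition literal :: "nat set \<Rightarrow> nat set \<Rightarrow> nat \<Rightarrow> real \<Rightarrow> real" where
  "literal I_pos I_neg k y = (if k \<in> I_pos then y else if k \<in> I_neg then 1 - y else 1)"

lemma sum_if_mem:
  fixes u v :: real
  assumes "finite R"
  shows "(\<Sum>j\<in>R. if j \<in> I then u else v)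
    = card (R \<inter> I) * u + (real (card R) - card (R \<inter> I)) * v"
proof -
  have "card R = card (R \<inter> I) + card (R - I)"
    using assms by (metis card_Int_Diff)
  then show ?thesis
    using assms by (simp add: sum.If_cases Diff_eq)
qed

locale near_uniform_weights =
  fixes J :: "nat set" and p a :: "nat \<Rightarrow> real" and I_pos I_neg :: "nat set" and \<alpha> :: real
  assumes weight_pos: "j \<in> J \<Longrightarrow> 0 < a j"
    and weight_ratio: "i \<in> J \<Longrightarrow> j \<in> J \<Longrightarrow> a i \<le> 2 * a j"
    and alpha: "0 < \<alpha>" "\<alpha> \<le> 1 / 2"
    and prob: "j \<in> J \<Longrightarrow> \<alpha> \<le> p j" "j \<in> J \<Longrightarrow> p j \<le> 1 - \<alpha>"
begin

abbreviation "I \<equiv> I_pos \<union> I_neg"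
abbreviation "f \<equiv> literal I_pos I_neg"
abbreviation "A \<equiv> average_value a f"

text \<open>In a collision the expected product of both literals is at most the literal of the
  carry, hence at most 1 / \<alpha> times the unbiased product; this is the relative gain.\<close>

definition excess :: real where "excess = 1 / \<alpha> - 1"

text \<open>This is \<open>2 / \<alpha> ^ 3 * (8 / 7)\<close>, the limit of the hazard as the
  literal of the carry tends to 0.\<close>

definition hazard_max :: real where "hazard_max = 16 / (7 * \<alpha> ^ 3)"

text \<open>
An upper bound for the total relative excess still to come from collisions of the carry \<open>c\<close> when it
has value \<open>x\<close>.
\<close>

definition hazard :: "nat \<Rightarrow> real \<Rightarrow> real" where
  "hazard c x = (if c \<in> I \<and> fractional x then 2 / \<alpha> ^ 3 * (8 / 7 - f c x) else 0)"

lemma fractional_prob: "j \<in> J \<Longrightarrow> fractional (p j)"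
  using prob alpha by (force simp: fractional_def)

lemma literal_unit: "x \<in> {0..1} \<Longrightarrow> f c x \<in> {0..1}"
  by (auto simp: literal_def)

lemma literal_notin [simp]: "c \<notin> I \<Longrightarrow> f c x = 1"
  by (auto simp: literal_def)

lemma literal_prob_ge: "j \<in> J \<Longrightarrow> \<alpha> \<le> f j (p j)"
  using prob[of j] alpha by (auto simp: literal_def)

lemma hazard_notin [simp]: "c \<notin> I \<Longrightarrow> hazard c x = 0"
  by (auto simp: hazard_def)

lemma hazard_not_fractional [simp]: "\<not> fractional x \<Longrightarrow> hazard c x = 0"
  by (simp add: hazard_def)

lemma excess_ge_1: "1 \<le> excess"
  using alpha by (simp add: excess_def field_simps)

lemma hazard_max_nonneg: "0 \<le> hazard_max"
  using alpha by (simp add: hazard_max_def)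

lemma hazard_nonneg: "0 \<le> hazard c x"
  and hazard_le: "hazard c x \<le> hazard_max"
proof -
  have "0 \<le> hazard c x \<and> hazard c x \<le> hazard_max"
  proof (cases "c \<in> I \<and> fractional x")
    case True
    then have f: "f c x \<in> {0..1}" by (intro literal_unit) (auto simp: fractional_def)
    then have "2 / \<alpha> ^ 3 * (8 / 7 - f c x) \<le> 2 / \<alpha> ^ 3 * (8 / 7)"
      using alpha by (intro mult_left_mono) auto
    moreover have "0 \<le> 2 / \<alpha> ^ 3 * (8 / 7 - f c x)"
      using alpha f by (intro mult_nonneg_nonneg) auto
    ultimately show ?thesis using True by (simp add: hazard_def hazard_max_def)
  next
    case False
    then show ?thesis using hazard_max_nonneg by (auto simp: hazard_def)
  qed
  then show "0 \<le> hazard c x" "hazard c x \<le> hazard_max" by auto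
qed

text \<open>A fractional carry from \<open>I\<close> can always pay for one collision, which keeps
  the hazard left after a step nonnegative. At least 1/7 remains of \<open>8 / 7 - f c x\<close>,
  and \<open>\<alpha>\<^sup>2 * (1 - \<alpha>)\<close> is at most 1/4, below 2/7.\<close>

lemma hazard_ge:
  assumes "c \<in> I" "fractional x"
  shows "excess \<le> hazard c x"
proof -
  have f: "f c x \<in> {0..1}" using assms by (intro literal_unit) (auto simp: fractional_def)
  have "\<alpha>\<^sup>2 \<le> (1 / 2)\<^sup>2"
    using alpha by (intro power_mono) auto
  then have "\<alpha>\<^sup>2 * (1 - \<alpha>) \<le> 1 / 4 * 1"
    using alpha by (intro mult_mono) (auto simp: power2_eq_square)
  then have "\<alpha>\<^sup>2 * (1 - \<alpha>) / \<alpha> ^ 3 \<le> 2 / 7 / \<alpha> ^ 3"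
    using alpha by (intro divide_right_mono) auto
  also have "\<alpha>\<^sup>2 * (1 - \<alpha>) / \<alpha> ^ 3 = excess"
    using alpha by (simp add: excess_def field_simps power2_eq_square power3_eq_cube)
  also have "2 / 7 / \<alpha> ^ 3 = 2 / \<alpha> ^ 3 * (1 / 7)"
    by simp
  also have "\<dots> \<le> 2 / \<alpha> ^ 3 * (8 / 7 - f c x)"
    using alpha f by (intro mult_left_mono) auto
  finally show ?thesis using assms by (simp add: hazard_def)
qed

lemma
  assumes "c \<in> J" "j \<in> J" "fractional x" "fractional y"
  shows expectation_literal_fst:
      "measure_pmf.expectation (simplify (a c) (a j) x y) (\<lambda>z. f k (fst z)) = f k x"
    and expectation_literal_snd:
      "measure_pmf.expectation (simplify (a c) (a j) x y) (\<lambda>z. f k (snd z)) = f k y"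
  using assms expectation_fst_simplify[of "a c" "a j" x y] expectation_snd_simplify[of "a c" "a j" x y]
  by (auto simp: literal_def weight_pos integrable_measure_pmf_finite)

text \<open>The factor \<open>f c\<close> realizes the reweighted law and turns the hazard into a
  multiple of \<open>drift_potential\<close>; the scaling converts its drift rate into
  \<open>excess\<close>.\<close>

lemma hazard_drift:
  assumes "c \<in> J" "j \<in> J" "c \<in> I" "fractional x"
  shows "measure_pmf.expectation (simplify (a c) (a j) x (p j)) (\<lambda>z. f c (fst z) * hazard c (fst z))
    \<le> f c x * (hazard c x - excess)"
proof -
  have pot: "f c u * hazard c u = 2 / \<alpha> ^ 3 * drift_potential (f c u)" for u
    using assms(3) by (auto simp: hazard_def drift_potential_def literal_def fractional_def)
  have "measure_pmf.expectation (simplify (a c) (a j) x (p j)) (\<lambda>z. drift_potential (f c (fst z)))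
      \<le> f c x * (8 / 7 - f c x) - \<alpha>\<^sup>2 * (1 - \<alpha>) / 2 * f c x"
  proof (cases "c \<in> I_pos")
    case True
    then show ?thesis
      using simplify_drift[of "a c" "a j" x \<alpha> "p j"] assms weight_pos weight_ratio alpha prob
      by (simp add: literal_def)
  next
    case False
    then show ?thesis
      using simplify_drift_compl[of "a c" "a j" x \<alpha> "p j"] assms weight_pos weight_ratio alpha prob
      by (simp add: literal_def)
  qed
  then have "2 / \<alpha> ^ 3 * measure_pmf.expectation (simplify (a c) (a j) x (p j))
        (\<lambda>z. drift_potential (f c (fst z)))
      \<le> 2 / \<alpha> ^ 3 * (f c x * (8 / 7 - f c x) - \<alpha>\<^sup>2 * (1 - \<alpha>) / 2 * f c x)"
    using alpha by (intro mult_left_mono) auto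
  also have "\<dots> = f c x * (2 / \<alpha> ^ 3 * (8 / 7 - f c x) - 2 / \<alpha> ^ 3 * (\<alpha>\<^sup>2 * (1 - \<alpha>) / 2))"
    by (simp add: right_diff_distrib mult_ac)
  also have "2 / \<alpha> ^ 3 * (\<alpha>\<^sup>2 * (1 - \<alpha>) / 2) = excess"
    using alpha by (simp add: excess_def field_simps power2_eq_square power3_eq_cube)
  finally show ?thesis
    unfolding pot using assms by (simp add: hazard_def)
qed

end

section \<open>Induction on the number of untouched indices\<close>

text \<open>
\<open>U k N + h * T k N\<close> bounds \<open>\<sigma>\<close> times the expected product, relative to the product of the current
values, when \<open>k\<close> of the \<open>N\<close> remaining indices lie in \<open>I\<close> and the carry has hazard \<open>h\<close>.  Taking \<open>\<sigma> = 1\<close>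
gives the upper and \<open>\<sigma> = -1\<close> the lower bound.  In \<open>collision\<close>, \<open>Z\<close> is the expected product after
a collision, \<open>W\<close> the expected and \<open>w\<close> the unbiased product of the current values.
\<close>

locale bounding_sequence = near_uniform_weights +
  fixes \<sigma> :: real and U T :: "nat \<Rightarrow> nat \<Rightarrow> real"
  assumes T_nonneg: "0 \<le> T k N"
    and U_base: "\<sigma> \<le> U 0 0"
    and T_step: "k \<le> N \<Longrightarrow> (real (Suc N) - k) * T k N \<le> Suc N * T k (Suc N)"
    and U_step: "k \<le> Suc N \<Longrightarrow> k * (U (k - 1) N + hazard_max * T (k - 1) N) + (real (Suc N) - k) * U k N
      \<le> Suc N * U k (Suc N)"
    and collision: "\<lbrakk>1 \<le> k; k \<le> Suc N; 0 \<le> Z; 0 \<le> W; W \<le> w / \<alpha>;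
        \<sigma> * Z \<le> W * (U (k - 1) N + hazard_max * T (k - 1) N)\<rbrakk>
      \<Longrightarrow> k * (\<sigma> * Z) \<le> w * (k * (U (k - 1) N + hazard_max * T (k - 1) N) + excess * (Suc N * T k (Suc N)))"
begin

abbreviation "V k N \<equiv> U k N + hazard_max * T k N"

text \<open>The induction invariant. Nonnegativity is carried along because \<open>collision\<close>
  asks for \<open>0 \<le> Z\<close>; the lower bound discards the product by its sign.\<close>

definition bounded_at :: "nat \<Rightarrow> nat set \<Rightarrow> (nat \<Rightarrow> real) \<Rightarrow> bool" where
  "bounded_at c R X \<longleftrightarrow> 0 \<le> A c R X \<and>
     \<sigma> * A c R X \<le> f c (X c) * (\<Prod>j\<in>R. f j (p j))
       * (U (card (R \<inter> I)) (card R) + hazard c (X c) * T (card (R \<inter> I)) (card R))"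

lemma prod_literal_pos: "R \<subseteq> J \<Longrightarrow> 0 < (\<Prod>j\<in>R. f j (p j))"
  using literal_prob_ge alpha by (intro prod_pos) (meson less_le_trans subsetD)

lemma card_remove_mem:
  assumes "finite R" "j \<in> R"
  shows "card ((R - {j}) \<inter> I) = (if j \<in> I then card (R \<inter> I) - 1 else card (R \<inter> I))"
proof (cases "j \<in> I")
  case True
  then have "(R - {j}) \<inter> I = (R \<inter> I) - {j}" by auto
  then show ?thesis using True assms by simp
next
  case False
  then have "(R - {j}) \<inter> I = R \<inter> I" by auto
  then show ?thesis using False by simp
qed

text \<open>A new carry is uniform in \<open>R\<close>. If it lies in \<open>I\<close>, one index of
  \<open>I\<close> is used up and its hazard is at most \<open>hazard_max\<close>; otherwise its
  hazard is 0. \<open>U_step\<close> is this average.\<close>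

lemma fresh_step:
  assumes R: "finite R" "card R = Suc N" "R \<subseteq> J"
    and X: "\<And>j. j \<in> R \<Longrightarrow> X j = p j"
    and IH: "\<And>j. j \<in> R \<Longrightarrow> bounded_at j (R - {j}) X"
  shows "0 \<le> (\<Sum>j\<in>R. A j (R - {j}) X) / card R"
    and "\<sigma> * ((\<Sum>j\<in>R. A j (R - {j}) X) / card R)
      \<le> (\<Prod>j\<in>R. f j (p j)) * U (card (R \<inter> I)) (Suc N)"
proof -
  let ?P = "\<Prod>j\<in>R. f j (p j)" and ?k = "card (R \<inter> I)"
  have k: "?k \<le> Suc N" using R by (metis card_mono inf_le1)
  have P: "0 < ?P" using prod_literal_pos R(3) .
  show "0 \<le> (\<Sum>j\<in>R. A j (R - {j}) X) / card R"
    using IH by (auto simp: bounded_at_def intro!: divide_nonneg_nonneg sum_nonneg)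
  have each: "\<sigma> * A j (R - {j}) X \<le> (if j \<in> I then ?P * V (?k - 1) N else ?P * U ?k N)"
    if j: "j \<in> R" for j
  proof -
    have split: "f j (p j) * (\<Prod>i\<in>R - {j}. f i (p i)) = ?P"
      using R(1) j by (simp add: prod.remove)
    have "\<sigma> * A j (R - {j}) X \<le> ?P * (U (card ((R - {j}) \<inter> I)) N
        + hazard j (p j) * T (card ((R - {j}) \<inter> I)) N)"
      using IH[OF j] R j by (simp add: bounded_at_def X split)
    also have "\<dots> \<le> (if j \<in> I then ?P * V (?k - 1) N else ?P * U ?k N)"
      using P hazard_le[of j "p j"] T_nonneg[of "?k - 1" N] card_remove_mem[OF R(1) j]
      by (auto intro!: mult_left_mono mult_right_mono)
    finally show ?thesis .
  qed
  have "\<sigma> * (\<Sum>j\<in>R. A j (R - {j}) X) \<le> (\<Sum>j\<in>R. if j \<in> I then ?P * V (?k - 1) N else ?P * U ?k N)"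
    unfolding sum_distrib_left by (intro sum_mono each)
  also have "\<dots> = ?P * (?k * V (?k - 1) N + (real (Suc N) - ?k) * U ?k N)"
    unfolding sum_if_mem[OF R(1)] R(2) by (simp add: algebra_simps)
  also have "\<dots> \<le> ?P * (Suc N * U ?k (Suc N))"
    using P U_step[OF k] by (intro mult_left_mono) auto
  finally show "\<sigma> * ((\<Sum>j\<in>R. A j (R - {j}) X) / card R) \<le> ?P * U ?k (Suc N)"
    using R(2) by (simp add: field_simps)
qed

text \<open>An index outside \<open>I\<close> lowers the hazard by \<open>excess\<close> on average,
  and that amount is what pays for the collisions when the next index lies in \<open>I\<close>. A
  carry outside \<open>I\<close> causes no bias, since the mean of its partner is preserved.\<close>

lemma carry_step:
  assumes R: "finite R" "card R = Suc N" "R \<subseteq> J" and c: "c \<in> J" "c \<notin> R" "fractional (X c)"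
    and X: "\<And>j. j \<in> R \<Longrightarrow> X j = p j"
    and IH: "\<And>d S X'. \<lbrakk>finite S; card S = N; S \<subseteq> J; d \<in> J; d \<notin> S; X' d \<in> {0..1};
        \<And>j. j \<in> S \<Longrightarrow> X' j = p j\<rbrakk> \<Longrightarrow> bounded_at d S X'"
  shows "bounded_at c R X"
proof -
  let ?P = "\<Prod>j\<in>R. f j (p j)" and ?k = "card (R \<inter> I)"
  let ?S = "\<lambda>j. simplify (a c) (a j) (X c) (p j)"
  let ?Z = "\<lambda>j z. if fractional (fst z)
      then f j (snd z) * A c (R - {j}) (X(c := fst z, j := snd z))
      else f c (fst z) * A j (R - {j}) (X(c := fst z, j := snd z))"
  define fx where "fx = f c (X c)"
  have k: "?k \<le> Suc N" using R by (metis card_mono inf_le1)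
  have P: "0 < ?P" using prod_literal_pos R(3) .
  have P': "0 \<le> (\<Prod>i\<in>R - {j}. f i (p i))" for j
    using prod_literal_pos[of "R - {j}"] R(3) by (simp add: less_imp_le subset_iff)
  have Xc: "X c \<in> {0..1}" using c(3) by (auto simp: fractional_def)
  have fx: "0 \<le> fx" using literal_unit[OF Xc] by (simp add: fx_def)
  have "R \<noteq> {}" using R(2) by auto
  then have A_eq: "A c R X = (\<Sum>j\<in>R. measure_pmf.expectation (?S j) (?Z j)) / Suc N"
    using average_value_step[of R c X a f] R c X fractional_prob
    by (auto simp: subset_iff intro!: sum.cong)
  \<comment> \<open>The hazard of whichever index is the carry after the step.\<close>
  define hz where "hz = (\<lambda>j z. if fractional (fst z) then hazard c (fst z) else hazard j (snd z))"
  have Z: "0 \<le> ?Z j z" "\<sigma> * ?Z j z \<le> f c (fst z) * f j (snd z) * (\<Prod>i\<in>R - {j}. f i (p i))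
        * (U (card ((R - {j}) \<inter> I)) N + hz j z * T (card ((R - {j}) \<inter> I)) N)"
      "fst z \<in> {0..1}" "snd z \<in> {0..1}"
    if j: "j \<in> R" and z: "z \<in> set_pmf (?S j)" for j z
  proof -
    let ?X = "X(c := fst z, j := snd z)"
    have jJ: "j \<in> J" and jc: "j \<noteq> c" using j R(3) c by auto
    have gh: "fst z \<in> {0..1}" "snd z \<in> {0..1}"
      using simplify_unit_interval[of "a c" "a j" "X c" "p j" "fst z" "snd z"]
        weight_pos jJ c fractional_prob z by simp_all
    have vals: "?X c = fst z" "?X j = snd z" "\<And>i. i \<in> R - {j} \<Longrightarrow> ?X i = p i"
      using jc X c(2) by auto
    have fin: "finite (R - {j})" "card (R - {j}) = N" "R - {j} \<subseteq> J" using R j by auto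
    have bc: "bounded_at c (R - {j}) ?X" and bj: "bounded_at j (R - {j}) ?X"
      using IH[OF fin c(1), of ?X] IH[OF fin jJ, of ?X] vals gh c(2) by auto
    have f01: "0 \<le> f c (fst z)" "0 \<le> f j (snd z)"
      using literal_unit[OF gh(1), of c] literal_unit[OF gh(2), of j] by auto
    show "0 \<le> ?Z j z"
      using bc bj f01 by (auto simp: bounded_at_def)
    let ?B = "\<lambda>\<eta>. (\<Prod>i\<in>R - {j}. f i (p i))
      * (U (card ((R - {j}) \<inter> I)) N + \<eta> * T (card ((R - {j}) \<inter> I)) N)"
    have "\<sigma> * A c (R - {j}) ?X \<le> f c (fst z) * ?B (hazard c (fst z))"
      "\<sigma> * A j (R - {j}) ?X \<le> f j (snd z) * ?B (hazard j (snd z))"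
      using bc bj unfolding bounded_at_def vals fin(2) by (simp_all only: mult.assoc)
    then have "f j (snd z) * (\<sigma> * A c (R - {j}) ?X) \<le> f j (snd z) * (f c (fst z) * ?B (hazard c (fst z)))"
      "f c (fst z) * (\<sigma> * A j (R - {j}) ?X) \<le> f c (fst z) * (f j (snd z) * ?B (hazard j (snd z)))"
      using f01 by (intro mult_left_mono; simp)+
    then show "\<sigma> * ?Z j z \<le> f c (fst z) * f j (snd z) * (\<Prod>i\<in>R - {j}. f i (p i))
        * (U (card ((R - {j}) \<inter> I)) N + hz j z * T (card ((R - {j}) \<inter> I)) N)"
      unfolding hz_def by (simp only: mult_ac split: if_split) simp
    show "fst z \<in> {0..1}" "snd z \<in> {0..1}" by (fact gh)+
  qed
  have hz: "0 \<le> hz j z" "hz j z \<le> hazard_max" for j z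
    using hazard_nonneg hazard_le by (simp_all add: hz_def)
  have EZ: "0 \<le> measure_pmf.expectation (?S j) (?Z j)" if "j \<in> R" for j
    using Z(1)[OF that] by (intro integral_nonneg_AE) (auto simp: AE_measure_pmf_iff)
  have inI: "\<sigma> * measure_pmf.expectation (?S j) (?Z j)
      \<le> measure_pmf.expectation (?S j) (\<lambda>z. f c (fst z) * f j (snd z))
        * (\<Prod>i\<in>R - {j}. f i (p i)) * V (?k - 1) N" if j: "j \<in> R" "j \<in> I" for j
  proof -
    have "\<sigma> * measure_pmf.expectation (?S j) (?Z j) = measure_pmf.expectation (?S j) (\<lambda>z. \<sigma> * ?Z j z)"
      by simp
    also have "\<dots> \<le> measure_pmf.expectation (?S j)
        (\<lambda>z. f c (fst z) * f j (snd z) * ((\<Prod>i\<in>R - {j}. f i (p i)) * V (?k - 1) N))"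
    proof (rule expectation_pmf_mono[OF finite_set_simplify])
      fix z assume z: "z \<in> set_pmf (?S j)"
      have "0 \<le> f c (fst z) * f j (snd z) * (\<Prod>i\<in>R - {j}. f i (p i))"
        using literal_unit[OF Z(3)[OF j(1) z], of c] literal_unit[OF Z(4)[OF j(1) z], of j]
          P'[of j]
        by (auto intro!: mult_nonneg_nonneg)
      then have "f c (fst z) * f j (snd z) * (\<Prod>i\<in>R - {j}. f i (p i))
          * (U (?k - 1) N + hz j z * T (?k - 1) N)
        \<le> f c (fst z) * f j (snd z) * (\<Prod>i\<in>R - {j}. f i (p i)) * V (?k - 1) N"
        using hz T_nonneg by (intro mult_left_mono add_left_mono mult_right_mono)
      then show "\<sigma> * ?Z j z
          \<le> f c (fst z) * f j (snd z) * ((\<Prod>i\<in>R - {j}. f i (p i)) * V (?k - 1) N)"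
        using Z(2)[OF j(1) z] j card_remove_mem[OF R(1) j(1)] by (simp only: if_True mult.assoc)
    qed
    also have "\<dots> = measure_pmf.expectation (?S j) (\<lambda>z. f c (fst z) * f j (snd z))
        * ((\<Prod>i\<in>R - {j}. f i (p i)) * V (?k - 1) N)"
      by (rule integral_mult_left_zero)
    finally show ?thesis by (simp only: mult.assoc)
  qed
  have Pj: "f j (p j) * (\<Prod>i\<in>R - {j}. f i (p i)) = ?P" if "j \<in> R" for j
    using R(1) that by (simp add: prod.remove)
  \<comment> \<open>The bound for one index of \<open>I\<close>, multiplied by their number as in
    \<open>collision\<close>.\<close>
  define Q where "Q = (if c \<in> I then ?k * V (?k - 1) N + excess * (Suc N * T ?k (Suc N)) else ?k * V (?k - 1) N)"
  have coll: "?k * (\<sigma> * measure_pmf.expectation (?S j) (?Z j)) \<le> fx * ?P * Q" if j: "j \<in> R" "j \<in> I" for j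
  proof -
    have jJ: "j \<in> J" using j R by auto
    have k1: "1 \<le> ?k" using j R(1) by (metis IntI One_nat_def Suc_leI card_gt_0_iff empty_iff finite_Int)
    let ?E = "measure_pmf.expectation (?S j) (\<lambda>z. f c (fst z) * f j (snd z))"
    have f01: "f c (fst z) \<in> {0..1}" "f j (snd z) \<in> {0..1}" if "z \<in> set_pmf (?S j)" for z
      using literal_unit[OF Z(3)[OF j(1) that], of c] literal_unit[OF Z(4)[OF j(1) that], of j] by auto
    show ?thesis
    proof (cases "c \<in> I")
      case True
      \<comment> \<open>Bounding the literal of \<open>j\<close> by 1 leaves a mean that the step
        preserves; the missing factor \<open>f j (p j)\<close> is at least \<alpha>, whence the loss
        of 1 / \<alpha>.\<close>
      have "?E \<le> measure_pmf.expectation (?S j) (\<lambda>z. f c (fst z))"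
        using f01 by (intro expectation_pmf_mono) (auto intro: mult_left_le)
      also have "\<dots> = fx"
        unfolding fx_def using c jJ fractional_prob by (intro expectation_literal_fst) auto
      finally have "?E * (\<Prod>i\<in>R - {j}. f i (p i)) \<le> fx * (\<Prod>i\<in>R - {j}. f i (p i))"
        using P'[of j] by (rule mult_right_mono)
      also have "\<dots> \<le> fx * (?P / \<alpha>)"
      proof (intro mult_left_mono fx)
        have "\<alpha> * (\<Prod>i\<in>R - {j}. f i (p i)) \<le> f j (p j) * (\<Prod>i\<in>R - {j}. f i (p i))"
          using literal_prob_ge[OF jJ] P'[of j] by (rule mult_right_mono)
        then show "(\<Prod>i\<in>R - {j}. f i (p i)) \<le> ?P / \<alpha>"
          using alpha Pj[OF j(1)] by (simp add: field_simps)
      qed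
      finally have W: "?E * (\<Prod>i\<in>R - {j}. f i (p i)) \<le> fx * ?P / \<alpha>" by simp
      have "0 \<le> ?E"
        using f01 by (intro integral_nonneg_AE) (auto simp: AE_measure_pmf_iff)
      then have "0 \<le> ?E * (\<Prod>i\<in>R - {j}. f i (p i))"
        using P'[of j] by (rule mult_nonneg_nonneg)
      then show ?thesis
        using collision[OF k1 k EZ[OF j(1)] _ W inI[OF j]] True unfolding Q_def by simp
    next
      case False
      have "?E = f j (p j)"
        using expectation_literal_snd[OF c(1) jJ c(3), of "p j" j] jJ fractional_prob False
        by simp
      then have "\<sigma> * measure_pmf.expectation (?S j) (?Z j) \<le> fx * ?P * V (?k - 1) N"
        using inI[OF j] Pj[OF j(1)] False by (simp add: fx_def)
      then have "?k * (\<sigma> * measure_pmf.expectation (?S j) (?Z j)) \<le> ?k * (fx * ?P * V (?k - 1) N)"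
        by (intro mult_left_mono) auto
      then show ?thesis using False by (simp add: Q_def mult_ac)
    qed
  qed
  \<comment> \<open>The hazard that remains after one \<open>excess\<close> has been paid.\<close>
  define H where "H = (if c \<in> I then hazard c (X c) - excess else 0)"
  have H: "0 \<le> H" using hazard_ge[OF _ c(3)] by (simp add: H_def)
  have notinI: "\<sigma> * measure_pmf.expectation (?S j) (?Z j) \<le> fx * ?P * (U ?k N + H * T ?k N)"
    if j: "j \<in> R" "j \<notin> I" for j
  proof -
    have jJ: "j \<in> J" using j R by auto
    let ?B = "\<lambda>z. f c (fst z) * U ?k N + f c (fst z) * hazard c (fst z) * T ?k N"
    have fj: "f j y = 1" for y using j by simp
    have Pj': "(\<Prod>i\<in>R - {j}. f i (p i)) = ?P" using Pj[OF j(1)] fj by simp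
    have "\<sigma> * measure_pmf.expectation (?S j) (?Z j) = measure_pmf.expectation (?S j) (\<lambda>z. \<sigma> * ?Z j z)"
      by simp
    also have "\<dots> \<le> measure_pmf.expectation (?S j) (\<lambda>z. ?P * ?B z)"
    proof (rule expectation_pmf_mono[OF finite_set_simplify])
      fix z assume z: "z \<in> set_pmf (?S j)"
      have "hz j z = hazard c (fst z)" using j by (simp add: hz_def)
      then show "\<sigma> * ?Z j z \<le> ?P * ?B z"
        using Z(2)[OF j(1) z] j card_remove_mem[OF R(1) j(1)] unfolding fj Pj'
        by (simp only: if_False) (simp add: algebra_simps)
    qed
    also have "\<dots> = ?P * (measure_pmf.expectation (?S j) (\<lambda>z. f c (fst z)) * U ?k N
        + measure_pmf.expectation (?S j) (\<lambda>z. f c (fst z) * hazard c (fst z)) * T ?k N)"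
      by (simp add: integrable_measure_pmf_finite)
    also have "measure_pmf.expectation (?S j) (\<lambda>z. f c (fst z)) = fx"
      unfolding fx_def using c jJ fractional_prob by (intro expectation_literal_fst) auto
    also have "?P * (fx * U ?k N
          + measure_pmf.expectation (?S j) (\<lambda>z. f c (fst z) * hazard c (fst z)) * T ?k N)
        \<le> ?P * (fx * U ?k N + fx * H * T ?k N)"
    proof (intro mult_left_mono add_left_mono mult_right_mono T_nonneg)
      show "measure_pmf.expectation (?S j) (\<lambda>z. f c (fst z) * hazard c (fst z)) \<le> fx * H"
        using hazard_drift[OF c(1) jJ _ c(3)] by (cases "c \<in> I") (simp_all add: H_def fx_def)
    qed (use P in simp)
    finally show ?thesis by (simp add: algebra_simps)
  qed
  have "\<sigma> * (\<Sum>j\<in>R. measure_pmf.expectation (?S j) (?Z j))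
      \<le> (\<Sum>j\<in>R. if j \<in> I then fx * ?P * Q / ?k else fx * ?P * (U ?k N + H * T ?k N))"
    unfolding sum_distrib_left
  proof (intro sum_mono)
    fix j assume j: "j \<in> R"
    show "\<sigma> * measure_pmf.expectation (?S j) (?Z j)
        \<le> (if j \<in> I then fx * ?P * Q / ?k else fx * ?P * (U ?k N + H * T ?k N))"
    proof (cases "j \<in> I")
      case True
      then have "0 < real ?k" using j R(1) by (auto simp: card_gt_0_iff)
      then have "\<sigma> * measure_pmf.expectation (?S j) (?Z j) \<le> fx * ?P * Q / ?k"
        using coll[OF j True] by (simp only: pos_le_divide_eq mult.commute)
      then show ?thesis using True by (simp only: if_True)
    next
      case False
      then show ?thesis using notinI[OF j False] by (simp only: if_False)
    qed
  qed
  also have "\<dots> = fx * ?P * (?k * (Q / ?k) + (real (Suc N) - ?k) * (U ?k N + H * T ?k N))"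
    unfolding sum_if_mem[OF R(1)] R(2) by (simp add: algebra_simps)
  also have "\<dots> \<le> fx * ?P * (Suc N * (U ?k (Suc N) + hazard c (X c) * T ?k (Suc N)))"
  proof (intro mult_left_mono)
    \<comment> \<open>For \<open>?k = 0\<close> the left side is 0 and \<open>Q\<close> is
      nonnegative; otherwise both sides agree.\<close>
    have kQ: "?k * (Q / ?k) \<le> Q"
    proof (cases "?k = 0")
      case True
      then show ?thesis using excess_ge_1 T_nonneg[of ?k "Suc N"] by (simp add: Q_def mult_nonneg_nonneg)
    qed simp
    have "(real (Suc N) - ?k) * T ?k N \<le> Suc N * T ?k (Suc N)"
    proof (cases "?k = Suc N")
      case True
      then show ?thesis using T_nonneg[of ?k "Suc N"] by simp
    next
      case False
      then show ?thesis using k by (intro T_step) simp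
    qed
    from mult_left_mono[OF this H]
    have HT: "(real (Suc N) - ?k) * (H * T ?k N) \<le> H * (Suc N * T ?k (Suc N))"
      by (simp only: mult_ac)
    \<comment> \<open>Outside \<open>I\<close> both the hazard and \<open>H\<close> are 0, so one
      formula serves both cases. The share \<open>hazard - H\<close> of \<open>T\<close> pays for
      collisions, the share \<open>H\<close> for the later steps.\<close>
    have Q: "Q = ?k * V (?k - 1) N + (hazard c (X c) - H) * (Suc N * T ?k (Suc N))"
      by (simp add: Q_def H_def)
    have "?k * (Q / ?k) + (real (Suc N) - ?k) * (U ?k N + H * T ?k N)
        \<le> Q + (real (Suc N) - ?k) * U ?k N + (real (Suc N) - ?k) * (H * T ?k N)"
      using kQ by (simp add: distrib_left)
    also have "\<dots> \<le> (?k * V (?k - 1) N + (real (Suc N) - ?k) * U ?k N)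
        + (hazard c (X c) - H) * (Suc N * T ?k (Suc N)) + H * (Suc N * T ?k (Suc N))"
      unfolding Q using HT by linarith
    also have "\<dots> \<le> Suc N * U ?k (Suc N) + hazard c (X c) * (Suc N * T ?k (Suc N))"
      using U_step[OF k] by (simp add: left_diff_distrib)
    finally show "?k * (Q / ?k) + (real (Suc N) - ?k) * (U ?k N + H * T ?k N)
        \<le> Suc N * (U ?k (Suc N) + hazard c (X c) * T ?k (Suc N))"
      by (simp only: distrib_left mult_ac)
  qed (use fx P in simp)
  finally have "\<sigma> * A c R X \<le> fx * ?P * (U ?k (Suc N) + hazard c (X c) * T ?k (Suc N))"
    unfolding A_eq by (simp add: field_simps)
  moreover have "0 \<le> A c R X"
    unfolding A_eq using EZ by (intro divide_nonneg_nonneg sum_nonneg) auto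
  ultimately show ?thesis
    unfolding bounded_at_def R(2) fx_def by simp
qed

text \<open>The value of \<open>c\<close> may be 0 or 1, since a step can settle both indices at
  once. Then the next index starts afresh from its initial probability.\<close>

lemma bounded_at:
  assumes "finite R" "R \<subseteq> J" "c \<in> J" "c \<notin> R" "X c \<in> {0..1}" "\<And>j. j \<in> R \<Longrightarrow> X j = p j"
  shows "bounded_at c R X"
  using assms
proof (induction "card R" arbitrary: c R X)
  case 0
  then have "R = {}" by simp
  have f: "0 \<le> f c (X c)" using literal_unit[OF "0.prems"(5)] by simp
  have "\<sigma> \<le> U 0 0 + hazard c (X c) * T 0 0"
    using U_base hazard_nonneg T_nonneg by (simp add: add_increasing2)
  then have "f c (X c) * \<sigma> \<le> f c (X c) * (U 0 0 + hazard c (X c) * T 0 0)"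
    using f by (rule mult_left_mono)
  then show ?case
    using f \<open>R = {}\<close> by (simp add: bounded_at_def mult.commute)
next
  case (Suc N)
  have cR: "card R = Suc N" using Suc.hyps(2) by simp
  have IH: "bounded_at d S X'" if "finite S" "card S = N" "S \<subseteq> J" "d \<in> J" "d \<notin> S"
    "X' d \<in> {0..1}" "\<And>j. j \<in> S \<Longrightarrow> X' j = p j" for d S X'
    using Suc.hyps(1)[of S d X'] that by simp
  show ?case
  proof (cases "fractional (X c)")
    case True
    show ?thesis
      by (rule carry_step[OF Suc.prems(1) cR Suc.prems(2-4) True Suc.prems(6) IH])
  next
    case False
    have "bounded_at j (R - {j}) X" if "j \<in> R" for j
    proof (rule IH)
      show "X j \<in> {0..1}"
        using fractional_prob[of j] that Suc.prems by (auto simp: fractional_def)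
    qed (use that Suc.prems cR in auto)
    note fresh = fresh_step[OF Suc.prems(1) cR Suc.prems(2,6) this]
    have f: "0 \<le> f c (X c)" using literal_unit[OF Suc.prems(5)] by simp
    have "A c R X = f c (X c) * ((\<Sum>j\<in>R. A j (R - {j}) X) / card R)"
      using Suc.prems False cR by (intro average_value_integral) auto
    then show ?thesis
      using mult_left_mono[OF fresh(2) f] mult_nonneg_nonneg[OF f fresh(1)] False cR
      unfolding bounded_at_def by (simp add: mult_ac)
  qed
qed

text \<open>The start of the rounding is a fresh step: every index is untouched and there is no
  carry.\<close>

lemma average_bound:
  assumes "finite J" "J \<noteq> {}"
  shows "\<sigma> * ((\<Sum>j\<in>J. A j (J - {j}) p) / card J) \<le> (\<Prod>j\<in>J. f j (p j)) * U (card (J \<inter> I)) (card J)"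
proof -
  obtain N where N: "card J = Suc N" using assms by (metis card_gt_0_iff gr0_implies_Suc)
  have "bounded_at j (J - {j}) p" if "j \<in> J" for j
    using that assms fractional_prob[of j] by (intro bounded_at) (auto simp: fractional_def)
  from fresh_step(2)[OF assms(1) N order_refl refl this] show ?thesis
    using N by simp
qed

end

section \<open>Upper and lower bounding sequences\<close>

definition choose_ratio :: "nat \<Rightarrow> nat \<Rightarrow> nat \<Rightarrow> real" where
  "choose_ratio k N s = real (k choose s) / real (N choose s)"

lemma choose_ratio_nonneg: "0 \<le> choose_ratio k N s"
  by (simp add: choose_ratio_def)

lemma choose_ratio_0 [simp]: "choose_ratio k N 0 = 1"
  by (simp add: choose_ratio_def)

text \<open>Condition on the occupant of the first of the given places; algebraically, the
  absorption identity for binomial coefficients.\<close>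

lemma choose_ratio_Suc:
  "choose_ratio k (Suc N) (Suc s) = k / Suc N * choose_ratio (k - 1) N s"
proof (cases k)
  case (Suc m)
  have absorb: "real (Suc i choose Suc s) = Suc i * real (i choose s) / Suc s" for i
    using arg_cong[OF Suc_times_binomial_eq[of i s], of real] by (simp add: field_simps)
  show ?thesis
    unfolding Suc choose_ratio_def absorb by (simp del: of_nat_Suc)
qed (simp add: choose_ratio_def)

text \<open>Condition on the occupant of a place other than the \<open>s\<close> given ones;
  \<open>s \<le> N\<close> ensures that one of the \<open>Suc N\<close> places is spare.\<close>

lemma choose_ratio_average:
  assumes "s \<le> N"
  shows "k * choose_ratio (k - 1) N s + (real (Suc N) - k) * choose_ratio k N s
    = Suc N * choose_ratio k (Suc N) s"
proof -
  have absorb: "i * real (i - 1 choose s) = (real i - s) * (i choose s)" for i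
  proof (cases "s \<le> i")
    case True
    then show ?thesis
      using arg_cong[OF binomial_absorb_comp[of i s], of real] by (simp add: of_nat_diff)
  next
    case False
    then show ?thesis by (simp add: binomial_eq_0)
  qed
  have pos: "0 < real (N choose s)" "0 < real (Suc N choose s)"
    using assms by (simp_all del: binomial_Suc_Suc)
  have "k * choose_ratio (k - 1) N s + (real (Suc N) - k) * choose_ratio k N s
      = (real (Suc N) - s) * (k choose s) / (N choose s)"
    unfolding choose_ratio_def times_divide_eq_right absorb add_divide_distrib[symmetric]
    by (simp add: algebra_simps)
  also have "\<dots> = Suc N * choose_ratio k (Suc N) s"
    using absorb[of "Suc N"] pos unfolding choose_ratio_def
    by (simp del: binomial_Suc_Suc add: frac_eq_eq mult_ac)
  finally show ?thesis .
qed

text \<open>Sampling without replacement: each success lowers the chance of the next one, as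
  \<open>(k - 1) / (N - 1)\<close> is at most \<open>k / N\<close>.\<close>

lemma choose_ratio_le_power:
  assumes "k \<le> N"
  shows "choose_ratio k N s \<le> (k / N) ^ s"
  using assms
proof (induction s arbitrary: k N)
  case (Suc s)
  show ?case
  proof (cases N)
    case 0
    then show ?thesis using Suc.prems by (simp add: choose_ratio_def)
  next
    case (Suc M)
    have "choose_ratio (k - 1) M s \<le> (k / N) ^ s"
    proof -
      have "choose_ratio (k - 1) M s \<le> (real (k - 1) / M) ^ s"
        using Suc.IH[of "k - 1" M] Suc.prems Suc by simp
      also have "\<dots> \<le> (k / N) ^ s"
      proof (intro power_mono)
        show "real (k - 1) / M \<le> k / N"
          using Suc.prems Suc by (cases k; cases M) (auto simp: field_simps)
      qed simp
      finally show ?thesis .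
    qed
    then have "k / N * choose_ratio (k - 1) M s \<le> k / N * (k / N) ^ s"
      by (intro mult_left_mono) auto
    then show ?thesis using Suc by (simp only: choose_ratio_Suc power_Suc)
  qed
qed simp

text \<open>
\<open>choose_ratio k N s\<close> is the probability that \<open>s\<close> given places of a random order of \<open>N\<close> indices are all
occupied by the \<open>k\<close> indices of \<open>I\<close>; \<open>gap_sum y m k N\<close> expands the product of the factors \<open>1 + excess\<close>
over \<open>m\<close> gaps between consecutive indices of \<open>I\<close>.
\<close>

definition gap_sum :: "real \<Rightarrow> nat \<Rightarrow> nat \<Rightarrow> nat \<Rightarrow> real" where
  "gap_sum y m k N = (\<Sum>s\<le>m. real (m choose s) * y ^ s * choose_ratio k N s)"

lemma gap_sum_nonneg: "0 \<le> y \<Longrightarrow> 0 \<le> gap_sum y m k N"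
  by (auto simp: gap_sum_def choose_ratio_nonneg intro!: sum_nonneg mult_nonneg_nonneg)

lemma gap_sum_0 [simp]: "gap_sum y 0 k N = 1"
  by (simp add: gap_sum_def)

text \<open>Pascal's rule separates the choices without and with one distinguished gap; in the
  latter \<open>choose_ratio_Suc\<close> fills one place first.\<close>

lemma gap_sum_Suc:
  "gap_sum y (Suc m) k (Suc N) = gap_sum y m k (Suc N) + y * (k / Suc N * gap_sum y m (k - 1) N)"
proof -
  let ?g = "\<lambda>s. y ^ s * choose_ratio k (Suc N) s"
  have "gap_sum y (Suc m) k (Suc N)
      = ?g 0 + (\<Sum>s\<le>m. real (m choose Suc s) * ?g (Suc s)) + (\<Sum>s\<le>m. real (m choose s) * ?g (Suc s))"
    unfolding gap_sum_def by (subst sum.atMost_Suc_shift) (simp add: sum.distrib algebra_simps)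
  also have "?g 0 + (\<Sum>s\<le>m. real (m choose Suc s) * ?g (Suc s)) = (\<Sum>s\<le>Suc m. real (m choose s) * ?g s)"
    by (subst sum.atMost_Suc_shift) simp
  also have "\<dots> = gap_sum y m k (Suc N)"
    by (simp add: gap_sum_def binomial_eq_0 mult.assoc)
  also have "(\<Sum>s\<le>m. real (m choose s) * ?g (Suc s)) = y * (k / Suc N * gap_sum y m (k - 1) N)"
    unfolding gap_sum_def sum_distrib_left choose_ratio_Suc
    by (intro sum.cong) (auto simp: mult_ac)
  finally show ?thesis .
qed

lemma gap_sum_average:
  assumes "m \<le> N"
  shows "k * gap_sum y m (k - 1) N + (real (Suc N) - k) * gap_sum y m k N
    = Suc N * gap_sum y m k (Suc N)"
proof -
  have "k * gap_sum y m (k - 1) N + (real (Suc N) - k) * gap_sum y m k N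
      = (\<Sum>s\<le>m. real (m choose s) * y ^ s
          * (k * choose_ratio (k - 1) N s + (real (Suc N) - k) * choose_ratio k N s))"
    unfolding gap_sum_def sum_distrib_left sum.distrib[symmetric]
    by (intro sum.cong refl) (simp only: distrib_left mult_ac)
  also have "\<dots> = (\<Sum>s\<le>m. real (m choose s) * y ^ s * (Suc N * choose_ratio k (Suc N) s))"
    using assms by (intro sum.cong refl) (simp only: atMost_iff choose_ratio_average order_trans)
  also have "\<dots> = Suc N * gap_sum y m k (Suc N)"
    unfolding gap_sum_def sum_distrib_left by (simp only: mult_ac)
  finally show ?thesis .
qed

lemma gap_sum_le:
  assumes "k \<le> N" "0 \<le> y"
  shows "gap_sum y m k N \<le> (1 + k * y / N) ^ m"
proof -
  have "gap_sum y m k N \<le> (\<Sum>s\<le>m. real (m choose s) * y ^ s * (k / N) ^ s)"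
    unfolding gap_sum_def using assms
    by (intro sum_mono mult_left_mono choose_ratio_le_power) auto
  also have "\<dots> = (k * y / N + 1) ^ m"
    unfolding binomial_ring by (simp add: power_mult_distrib power_divide mult_ac)
  finally show ?thesis by (simp add: add.commute)
qed

context near_uniform_weights
begin

text \<open>The \<open>k\<close> indices of \<open>I\<close> have \<open>k - 1\<close> gaps between
  them, whence \<open>U\<close>; a carry from \<open>I\<close> opens one more, and
  \<open>gap_sum_Suc\<close> identifies \<open>T\<close> as the increment divided by
  \<open>hazard_max\<close>. At a collision 1 / \<alpha> is \<open>1 + excess\<close>, and
  \<open>T\<close> supplies exactly the second part.\<close>

lemma upper_bounding_sequence:
  "bounding_sequence J p a \<alpha> 1 (\<lambda>k N. gap_sum hazard_max (k - 1) k N)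
     (\<lambda>k N. k / N * gap_sum hazard_max (k - 1) (k - 1) (N - 1))"
proof -
  let ?y = hazard_max
  let ?U = "\<lambda>k N. gap_sum ?y (k - 1) k N"
  let ?T = "\<lambda>k N. real k / real N * gap_sum ?y (k - 1) (k - 1) (N - 1)"
  have y: "0 \<le> ?y" by (rule hazard_max_nonneg)
  have V: "?U k N + ?y * ?T k N = gap_sum ?y k k N" if kN: "k \<le> N" for k N
  proof (cases k)
    case (Suc m)
    then obtain M where "N = Suc M" using kN by (cases N) auto
    then show ?thesis using gap_sum_Suc[of ?y m k M] Suc by simp
  qed simp
  have T_Suc: "Suc N * ?T k (Suc N) = k * gap_sum ?y (k - 1) (k - 1) N" for k N
    by simp
  show ?thesis
  proof unfold_locales
    fix k N
    show "0 \<le> ?T k N"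
      using gap_sum_nonneg[OF y] by (intro mult_nonneg_nonneg) auto
  next
    show "1 \<le> ?U 0 0" by simp
  next
    fix k N :: nat assume "k \<le> N"
    show "(real (Suc N) - k) * ?T k N \<le> Suc N * ?T k (Suc N)"
    proof (cases k)
      case (Suc m)
      then obtain M where N: "N = Suc M" and m: "m \<le> M" using \<open>k \<le> N\<close> by (cases N) auto
      \<comment> \<open>The first summand of the averaging identity is nonnegative; omitting it
        leaves the claim up to a common factor.\<close>
      have "0 \<le> m * gap_sum ?y m (m - 1) M" using gap_sum_nonneg[OF y] by simp
      then have "(real (Suc M) - m) * gap_sum ?y m m M \<le> Suc M * gap_sum ?y m m (Suc M)"
        using gap_sum_average[OF m, of m ?y] by linarith
      then have "k * ((real (Suc M) - m) * gap_sum ?y m m M / Suc M) \<le> k * gap_sum ?y m m (Suc M)"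
        by (intro mult_left_mono) (simp_all add: field_simps)
      then show ?thesis unfolding T_Suc using Suc N by (simp add: mult_ac add_diff_eq)
    qed simp
  next
    fix k N :: nat assume k: "k \<le> Suc N"
    then have k1: "k - 1 \<le> N" by simp
    show "real k * (?U (k - 1) N + ?y * ?T (k - 1) N) + (real (Suc N) - k) * ?U k N
        \<le> Suc N * ?U k (Suc N)"
      unfolding V[OF k1] gap_sum_average[OF k1] by (rule order_refl)
  next
    fix k N :: nat and Z W w :: real
    assume k: "1 \<le> k" "k \<le> Suc N" and W: "W \<le> w / \<alpha>"
      and Z: "1 * Z \<le> W * (?U (k - 1) N + ?y * ?T (k - 1) N)"
    let ?V = "gap_sum ?y (k - 1) (k - 1) N"
    have V': "?U (k - 1) N + ?y * ?T (k - 1) N = ?V" using k by (intro V) simp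
    have "Z \<le> W * ?V" using Z unfolding V' by simp
    also have "\<dots> \<le> w / \<alpha> * ?V"
      using W gap_sum_nonneg[OF y] by (intro mult_right_mono)
    finally have "k * Z \<le> k * (w / \<alpha> * ?V)"
      by (intro mult_left_mono) auto
    also have "\<dots> = w * (k * ?V + excess * (k * ?V))"
      by (simp add: excess_def algebra_simps)
    finally show "k * (1 * Z) \<le> w * (k * (?U (k - 1) N + ?y * ?T (k - 1) N) + excess * (Suc N * ?T k (Suc N)))"
      unfolding V' T_Suc by simp
  qed
qed

text \<open>A collision may destroy the whole product, a relative loss of 1, which
  \<open>excess\<close> covers as \<alpha> is at most 1/2. A first-order bound then suffices:
  \<open>T\<close> is the chance that the next index lies in \<open>I\<close>, and \<open>U\<close>
  satisfies its recursion with equality for positive \<open>N\<close>.\<close>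

lemma lower_bounding_sequence:
  "bounding_sequence J p a \<alpha> (-1) (\<lambda>k N. real k * (real k - 1) * hazard_max / N - 1)
     (\<lambda>k N. k / N)"
proof -
  let ?y = hazard_max
  let ?U = "\<lambda>k N. real k * (real k - 1) * ?y / real N - 1"
  let ?T = "\<lambda>k N. real k / real N"
  have y: "0 \<le> ?y" by (rule hazard_max_nonneg)
  show ?thesis
  proof unfold_locales
    fix k N :: nat assume "k \<le> N"
    show "(real (Suc N) - k) * ?T k N \<le> Suc N * ?T k (Suc N)"
    proof (cases "k = 0")
      case False
      then have "(real (Suc N) - k) * ?T k N \<le> N * ?T k N"
        by (intro mult_right_mono) auto
      then show ?thesis using False \<open>k \<le> N\<close> by simp
    qed simp
  next
    fix k N :: nat assume k: "k \<le> Suc N"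
    show "real k * (?U (k - 1) N + ?y * ?T (k - 1) N) + (real (Suc N) - k) * ?U k N
        \<le> Suc N * ?U k (Suc N)"
    \<comment> \<open>For \<open>N = 0\<close> quotients by \<open>N\<close> are 0 by convention,
      and \<open>k \<le> 1\<close> makes \<open>k * (k - 1)\<close> vanish as well.\<close>
    proof (cases "k = 0 \<or> N = 0")
      case True
      then show ?thesis using k by (cases k) auto
    next
      case False
      then show ?thesis by (simp add: of_nat_diff field_simps)
    qed
  next
    fix k N :: nat and Z W w :: real
    assume k: "1 \<le> k" "k \<le> Suc N" and Z: "0 \<le> Z" and W: "0 \<le> W" "W \<le> w / \<alpha>"
    have w: "0 \<le> w" using order_trans[OF W] alpha by (simp add: zero_le_divide_iff)
    have "0 \<le> real (k - 1) * (real (k - 1) - 1)" by (cases "k - 1") auto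
    then have "- 1 \<le> ?U (k - 1) N + ?y * ?T (k - 1) N"
      using y by (simp add: mult_nonneg_nonneg)
    \<comment> \<open>The bound after a collision is at least -1 and \<open>excess\<close> at least
      1, so the right side is nonnegative while the left is at most 0.\<close>
    then have "- 1 + 1 \<le> ?U (k - 1) N + ?y * ?T (k - 1) N + excess"
      using excess_ge_1 by (intro add_mono)
    then have nonneg: "0 \<le> w * (k * (?U (k - 1) N + ?y * ?T (k - 1) N + excess))"
      using w by (intro mult_nonneg_nonneg) auto
    have "k * (- 1 * Z) \<le> 0" using Z by (simp add: mult_nonneg_nonneg)
    also note nonneg
    also have "w * (k * (?U (k - 1) N + ?y * ?T (k - 1) N + excess))
        = w * (k * (?U (k - 1) N + ?y * ?T (k - 1) N) + excess * (Suc N * ?T k (Suc N)))"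
    proof -
      have "Suc N * ?T k (Suc N) = k" by simp
      then show ?thesis by (simp only: distrib_left mult_ac)
    qed
    finally show "k * (- 1 * Z) \<le> w * (k * (?U (k - 1) N + ?y * ?T (k - 1) N)
        + excess * (Suc N * ?T k (Suc N)))" .
  qed simp_all
qed

lemma
  assumes J: "finite J" "J \<noteq> {}"
  defines "t \<equiv> card (J \<inter> I)" and "n \<equiv> card J"
    and "F \<equiv> (\<Sum>j\<in>J. A j (J - {j}) p) / card J"
  shows average_value_ge: "(1 - 16 * real t * (real t - 1) / (7 * real n * \<alpha> ^ 3))
          * (\<Prod>j\<in>J. f j (p j)) \<le> F"
    and average_value_le: "F \<le> (1 + 16 * real t / (7 * real n * \<alpha> ^ 3)) ^ (t - 1) * (\<Prod>j\<in>J. f j (p j))"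
proof -
  let ?P = "\<Prod>j\<in>J. f j (p j)"
  have tn: "t \<le> n" unfolding t_def n_def using J by (intro card_mono) auto
  have P: "0 \<le> ?P"
  proof (intro prod_nonneg ballI)
    show "0 \<le> f j (p j)" if "j \<in> J" for j
      using literal_prob_ge[OF that] alpha by simp
  qed
  have "-1 * F \<le> ?P * (real t * (real t - 1) * hazard_max / n - 1)"
    unfolding F_def t_def n_def
    by (rule bounding_sequence.average_bound[OF lower_bounding_sequence J])
  then show "(1 - 16 * real t * (real t - 1) / (7 * real n * \<alpha> ^ 3)) * ?P \<le> F"
    by (simp add: hazard_max_def algebra_simps)
  have "1 * F \<le> ?P * gap_sum hazard_max (t - 1) t n"
    unfolding F_def t_def n_def
    by (rule bounding_sequence.average_bound[OF upper_bounding_sequence J])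
  also have "\<dots> \<le> ?P * (1 + t * hazard_max / n) ^ (t - 1)"
    using P tn hazard_max_nonneg by (intro mult_left_mono gap_sum_le)
  finally show "F \<le> (1 + 16 * real t / (7 * real n * \<alpha> ^ 3)) ^ (t - 1) * ?P"
    by (simp add: hazard_max_def mult_ac)
qed

end

section \<open>Specialization to the original product and parameters\<close>

lemma prod_literal:
  assumes "finite J" "I_pos \<subseteq> J" "I_neg \<subseteq> J" "I_pos \<inter> I_neg = {}"
  shows "(\<Prod>k\<in>J. literal I_pos I_neg k (X k)) = (\<Prod>i\<in>I_pos. X i) * (\<Prod>i\<in>I_neg. 1 - X i)"
proof -
  have fin: "finite I_pos" "finite I_neg" using assms(1-3) by (auto dest: finite_subset)
  have "(\<Prod>k\<in>J. literal I_pos I_neg k (X k)) = (\<Prod>k\<in>I_pos \<union> I_neg. literal I_pos I_neg k (X k))"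
    using assms by (intro prod.mono_neutral_right) (auto simp: literal_def)
  also have "\<dots> = (\<Prod>k\<in>I_pos. literal I_pos I_neg k (X k)) * (\<Prod>k\<in>I_neg. literal I_pos I_neg k (X k))"
    using assms fin by (intro prod.union_disjoint)
  \<comment> \<open>Disjointness keeps the earlier test for \<open>I_pos\<close> in
    \<open>literal\<close> from capturing an index of \<open>I_neg\<close>.\<close>
  also have "\<dots> = (\<Prod>i\<in>I_pos. X i) * (\<Prod>i\<in>I_neg. 1 - X i)"
    using assms(4) by (intro arg_cong2[where f = "(*)"] prod.cong) (auto simp: literal_def)
  finally show ?thesis .
qed

theorem theorem2p10:
  fixes n t :: nat
    and p a :: "nat \<Rightarrow> real"
    and I_pos I_neg I :: "nat set"
    and \<alpha> \<Lambda> :: real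
  assumes "n \<ge> 1"
    and "\<forall>i\<in>{1..n}. 0 < p i \<and> p i < 1"
    and "\<forall>i\<in>{1..n}. 0 < a i"
    and "I_pos \<subseteq> {1..n}" and "I_neg \<subseteq> {1..n}" and "I_pos \<inter> I_neg = {}"
    and "I = I_pos \<union> I_neg"
    and "t = card I"
    and "\<alpha> = (MIN i\<in>{1..n}. min (p i) (1 - p i))"
    and "\<Lambda> = (\<Prod>i\<in>I_pos. p i) * (\<Prod>i\<in>I_neg. 1 - p i)"
    and "(MAX (i, j)\<in>{1..n} \<times> {1..n}. a i / a j) \<le> 2"
  shows "(1 - 16 * real t * (real t - 1) / (7 * real n * \<alpha> ^ 3)) * \<Lambda>
           \<le> measure_pmf.expectation (dep_round n p a)
               (\<lambda>X. (\<Prod>i\<in>I_pos. X i) * (\<Prod>i\<in>I_neg. 1 - X i))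
       \<and> measure_pmf.expectation (dep_round n p a)
               (\<lambda>X. (\<Prod>i\<in>I_pos. X i) * (\<Prod>i\<in>I_neg. 1 - X i))
           \<le> (1 + 16 * real t / (7 * real n * \<alpha> ^ 3)) powi (int t - 1) * \<Lambda>"
proof -
  let ?J = "{1..n}"
  have J: "finite ?J" "?J \<noteq> {}" using assms(1) by auto
  have \<alpha>_le: "\<alpha> \<le> min (p i) (1 - p i)" if "i \<in> ?J" for i
    unfolding assms(9) using that by (intro Min_le) auto
  have "\<alpha> \<in> (\<lambda>i. min (p i) (1 - p i)) ` ?J"
    unfolding assms(9) using J by (intro Min_in) auto
  then have \<alpha>: "0 < \<alpha>" "\<alpha> \<le> 1 / 2"
    using assms(2) by (auto simp: min_def)
  have ratio: "a i \<le> 2 * a j" if "i \<in> ?J" "j \<in> ?J" for i j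
  proof -
    have "a i / a j \<le> (MAX (i, j)\<in>?J \<times> ?J. a i / a j)"
      using that by (intro Max_ge) (auto intro!: image_eqI[of _ _ "(i, j)"])
    then have "a i / a j \<le> 2" using assms(11) by linarith
    then show ?thesis using assms(3) that by (simp add: field_simps)
  qed
  interpret near_uniform_weights ?J p a I_pos I_neg \<alpha>
  proof
    show "\<alpha> \<le> p j" "p j \<le> 1 - \<alpha>" if "j \<in> ?J" for j
      using \<alpha>_le[OF that] by auto
  qed (use assms(3) ratio \<alpha> in auto)
  have IJ: "?J \<inter> (I_pos \<union> I_neg) = I" using assms(4,5,7) by auto
  have "measure_pmf.expectation (dep_round n p a) (\<lambda>X. (\<Prod>i\<in>I_pos. X i) * (\<Prod>i\<in>I_neg. 1 - X i))
      = (\<Sum>j\<in>?J. average_value a (literal I_pos I_neg) j (?J - {j}) p) / card ?J"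
    using expectation_dep_round[OF assms(1), of p a "literal I_pos I_neg"]
    unfolding prod_literal[OF J(1) assms(4-6)] by simp
  moreover have "\<Lambda> = (\<Prod>j\<in>?J. literal I_pos I_neg j (p j))"
    unfolding prod_literal[OF J(1) assms(4-6)] by (rule assms(10))
  \<comment> \<open>For \<open>t = 0\<close> the integer exponent is -1 and the truncated one is 0,
    but the base is then 1.\<close>
  moreover have "(1 + 16 * real t / (7 * real n * \<alpha> ^ 3)) powi (int t - 1)
      = (1 + 16 * real t / (7 * real n * \<alpha> ^ 3)) ^ (t - 1)"
  proof (cases t)
    case (Suc m)
    then have "int t - 1 = int (t - 1)" by simp
    then show ?thesis by (simp only: power_int_of_nat)
  qed simp
  ultimately show ?thesis
    using average_value_ge[OF J] average_value_le[OF J] unfolding IJ assms(8) by simp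
qed

end
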